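(* Let a production network $G=(\mathcal V,\mathcal C)$ with $\mathcal C=\{1,\dots,N\}$ be given (with external inflows of bounded variation, $\operatorname{TV}_{(0,T)}(G^v_{\rm in})<\infty$ for all $v\in V_{\rm in}$). Let $C^1,\dots,C^N\in\mathbb N$, let $\mu:\prod_{e=1}^N\{1,\dots,C^e\}\to\mathbb R_{\ge0}^N$, $\mu(\vec r)=(\mu^1(r_1),\dots,\mu^N(r_N))$, be a capacity function, and for $e\in\mathcal C$, $i,j\in\{1,\dots,C^e\}$ let $$\lambda^e_{ij}:[0,T]\times\mathbb R_{\ge0}\times L^1((a^e,b^e))\to\mathbb R_{\ge0}$$ be continuous functions satisfying $\lambda^e_{ii}=\sum_{j=1,\,j\ne i}^{C^e}\lambda^e_{ij}$ and, for some constants $\overline{\lambda^e}<\infty$, $$\sup\{\lambda^e_{ij}(t,q,\rho): i,j=1,\dots,C^e,\ t\in[0,T],\ (q,\rho)\in\mathbb R_{\ge0}\times L^1((a^e,b^e))\}\le\overline{\lambda^e}.$$ Then for every initial datum $x_0=(\vec r_0,\vec q_0,\vec\rho_0)\in E$ there exists a Markovian load-dependent production network model (MLDPNM) with initial datum $x_0$, transition rate functions $\lambda^e_{ij}$ and capacity function $\mu$.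
   Context: **Production network.** $G=(\mathcal V,\mathcal C)$ is a directed graph with arc set $\mathcal C=\{1,\dots,N\}$ (processors) and nonempty vertex set $\mathcal V$; $T>0$ is a time horizon. Arc $e$ starts at the vertex $s(e)$, is identified with an interval $[a^e,b^e]\subset\mathbb R$, and has a processing velocity $v^e>0$; its queue sits at $x=a^e$. $\delta_v^-,\delta_v^+$ are the sets of ingoing and outgoing arcs of $v$. At each $v\in V_{\rm in}=\{v:\delta_v^-=\emptyset\}$ an inflow function $G^v_{\rm in}(t)$ is prescribed, and for each $v$ with $\delta_v^+\neq\emptyset$ distribution rates $A^{v,e}(t)\in[0,1]$, $e\in\delta_v^+$, are given with $\sum_{e\in\delta_v^+}A^{v,e}(t)=1$. **Deterministic dynamics.** Fix constant capacities $m=(m^1,\dots,m^N)\in\mathbb R_{\ge0}^N$, a starting time $s\in[0,T]$ and initial data $(q_0^e,\rho_0^e)_e$ at time $s$. For $t\in[s,T]$, $x\in(a^e,b^e)$: $$\partial_t\rho^e+\partial_xf^e(\rho^e)=0,\quad f^e(\rho)=\min\{v^e\rho,m^e\},\quad \rho^e(x,s)=\rho^e_0(x),\quad v^e\rho^e(a^e,t)=g^e_{\rm out}(t),$$ $$\partial_tq^e(t)=g^e_{\rm in}(t)-g^e_{\rm out}(t),\quad q^e(s)=q^e_0,$$ where $g^e_{\rm in}(t)=A^{s(e),e}(t)\sum_{\tilde e\in\delta^-_{s(e)}}f^{\tilde e}(\rho^{\tilde e}(b^{\tilde e},t))$ if $s(e)\notin V_{\rm in}$ and $g^e_{\rm in}(t)=G^{s(e)}_{\rm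 in}(t)$ if $s(e)\in V_{\rm in}$; and $g^e_{\rm out}(t)=\min\{g^e_{\rm in}(t),m^e\}$ if $q^e(t)=0$, $g^e_{\rm out}(t)=m^e$ if $q^e(t)>0$. A *network solution* is $(q^e,\rho^e)_e$ such that $q^e(t)=q^e_0+\int_s^t(g^e_{\rm in}-g^e_{\rm out})\,d\tau$ and each $\rho^e$ is a weak entropy solution, i.e. $\rho^e\in BV((a^e,b^e)\times(s,T))$ (Tonelli–Cesari bounded variation), $\rho^e(\cdot,s)=\rho^e_0$ a.e., and for all $k\in\mathbb R$ and all $0\le\varphi\in C^2_0([a^e,b^e)\times(s,T))$ $$\int_s^T\!\!\int_{a^e}^{b^e}|\rho^e-k|\varphi_t+\operatorname{sgn}(\rho^e-k)(f^e(\rho^e)-f^e(k))\varphi_x\,dx\,dt\ \ge\ -\int_s^T\operatorname{sgn}\!\Big(\tfrac{g^e_{\rm out}(t)}{v^e}-k\Big)\big(f^e(\rho^e(a^e+,t))-f^e(k)\big)\varphi(a^e,t)\,dt,$$ where $\rho^e(a^e+,t)$ is the limit $x\searrow a^e$ outside a null set. **Solution operator.** Let $D=\mathbb R_{\ge0}^N\times\prod_{e=1}^NL^1((a^e,b^e))$ with $\|(\vec q,\vec\rho)\|=\sum_e(\|\rho^e\|_{L^1}+|q^e|)$, and $\tilde D=\{(\vec q,\vec\rho)\in D:\operatorname{TV}_{(a^e,b^e)}(\rho^e)<\infty\ \forall e\}$. It is a known result (taken as given) that, when all $\operatorname{TV}_{(0,T)}(G^v_{\rm in})<\infty$, for each $m$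 there is a family $S^m_{st}:D\to D$, $0\le s\le t\le T$, with: $S^m_{ss}=\mathrm{Id}$ and $S^m_{su}=S^m_{tu}S^m_{st}$ for $s\le t\le u$; $t\mapsto S^m_{st}u$ continuous; $\|S^m_{st}u-S^m_{st}\tilde u\|\le\|u-\tilde u\|$; for $u\in\tilde D$, $t\mapsto S^m_{st}u$ is the unique network solution started at time $s$ from $u$, and $S^m_{st}u\in\tilde D$; for $u\in\tilde D$ there is $\tilde L>0$, independent of $s$, with $\|S^m_{st}u-S^m_{st'}u\|\le\tilde L|t-t'|$. ($S^m$ is the continuous extension to $D$ of the solution operator on the dense subset $\tilde D$.) **State space.** $E=\prod_{e=1}^N\{1,\dots,C^e\}\times D$, with discrete topology on the first factor, and its Borel $\sigma$-algebra $\mathcal E$; $E$ is Polish. Elements are written $(\vec r,\vec q,\vec\rho)$. **MLDPNM.** Given rate functions $\lambda^e_{ij}$ and a capacity function $\mu$, an MLDPNM with initial datum $x_0\in E$ is a stochastic process $X=((\vec r(t),\vec q(t),\vec\rho(t)),t\in[0,T])$ with values in $E$ on some probability space $(\Omega,\mathcal A,P)$ such that: 1. $X(0)=x_0$ $P$-a.s. 2. $X$ is a Markov process with respect to its natural filtration. 3. For every $t\in(0,T)$, $(\vec r,\vec q,\vec\rho)\in E$, every $e=1,\dots,N$ and $j=1,\dots,C^e$, as $\Delta t\to0$ ($\Delta t>0$), $$P\big(r^e(t+\Delta t)=j\,\big|\,X(t)=(\vec r,\vec q,\vec\rho)\big)=\big(1-\Delta t\,\lambda^e_{r^er^e}(t,q^e,\rho^e)\big)\mathbf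 1_{\{j=r^e\}}+\Delta t\,\lambda^e_{r^ej}(t,q^e,\rho^e)\mathbf 1_{\{j\ne r^e\}}+o(\Delta t).$$ Here the conditional probabilities given $X(t)=y$ are understood via a transition function of the Markov process $X$, i.e. a family of Markov kernels $(p_{st})_{0\le s\le t\le T}$ on $E$ satisfying the Chapman–Kolmogorov equations with $P(X(t)\in B\mid X(s))=p_{st}(X(s),B)$ a.s. 4. There is a $P$-null set $\mathcal N\in\mathcal A$ such that for every $\omega\in\mathcal N^c$ there exist $M$ and times $0=T_0\le T_1\le\dots\le T_M=T$ (depending on $\omega$) such that for $k=0,\dots,M-1$ the function $t\mapsto\mu(\vec r(t,\omega))$ is constant on $[T_k,T_{k+1})$ and $$(\vec q(t,\omega),\vec\rho(t,\omega))=S^{\mu(\vec r(T_k,\omega))}_{T_kt}(\vec q(T_k,\omega),\vec\rho(T_k,\omega)),\qquad t\in[T_k,T_{k+1}).$$ *)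

theory Defs
  imports "HOL-Probability.Probability" "Graph_Theory.Digraph"
begin

section \<open>The Banach space \<open>L\<^sup>1\<close>\<close>

definition l1_rel :: "(real \<Rightarrow> real) \<Rightarrow> (real \<Rightarrow> real) \<Rightarrow> bool" where
  "l1_rel f g \<longleftrightarrow> integrable lborel f \<and> integrable lborel g \<and> (AE x in lborel. f x = g x)"

lemma part_equivp_l1_rel: "part_equivp l1_rel"
proof (rule part_equivpI)
  show "\<exists>f. l1_rel f f" by (rule exI[of _ "\<lambda>_. 0"]) (simp add: l1_rel_def)
  show "symp l1_rel" by (rule sympI) (auto simp: l1_rel_def elim: eventually_mono)
  show "transp l1_rel" by (rule transpI) (auto simp: l1_rel_def elim: eventually_elim2)
qed

quotient_type l1 = "real \<Rightarrow> real" / partial: l1_rel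
  by (rule part_equivp_l1_rel)

instantiation l1 :: real_normed_vector
begin

lift_definition zero_l1 :: l1 is "\<lambda>_. 0"
  by (simp add: l1_rel_def)

lift_definition plus_l1 :: "l1 \<Rightarrow> l1 \<Rightarrow> l1" is "\<lambda>f g x. f x + g x"
  by (auto simp: l1_rel_def elim: eventually_elim2)

lift_definition minus_l1 :: "l1 \<Rightarrow> l1 \<Rightarrow> l1" is "\<lambda>f g x. f x - g x"
  by (auto simp: l1_rel_def elim: eventually_elim2)

lift_definition uminus_l1 :: "l1 \<Rightarrow> l1" is "\<lambda>f x. - f x"
  by (auto simp: l1_rel_def elim: eventually_mono)

lift_definition scaleR_l1 :: "real \<Rightarrow> l1 \<Rightarrow> l1" is "\<lambda>c f x. c * f x"
  by (auto simp: l1_rel_def elim: eventually_mono)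

lift_definition norm_l1 :: "l1 \<Rightarrow> real" is "\<lambda>f. LINT x|lborel. \<bar>f x\<bar>"
  unfolding l1_rel_def
  by (intro integral_cong_AE) (auto elim: eventually_mono)

definition dist_l1 :: "l1 \<Rightarrow> l1 \<Rightarrow> real" where
  "dist_l1 f g = norm (f - g)"

definition sgn_l1 :: "l1 \<Rightarrow> l1" where
  "sgn_l1 f = scaleR (inverse (norm f)) f"

definition uniformity_l1 :: "(l1 \<times> l1) filter" where
  "uniformity_l1 = (INF e\<in>{0<..}. principal {(f, g). dist f g < e})"

definition open_l1 :: "l1 set \<Rightarrow> bool" where
  "open_l1 U \<longleftrightarrow> (\<forall>f\<in>U. eventually (\<lambda>(f', g). f' = f \<longrightarrow> g \<in> U) uniformity)"

instance
proof
  fix f g h :: l1 and c d :: real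
  show "f + g + h = f + (g + h)"
    by transfer (auto simp: l1_rel_def add.assoc)
  show "f + g = g + f"
    by transfer (auto simp: l1_rel_def add.commute)
  show "0 + f = f" by transfer (auto simp: l1_rel_def)
  show "- f + f = 0" by transfer (auto simp: l1_rel_def)
  show "f - g = f + - g" by transfer (auto simp: l1_rel_def)
  show "scaleR c (f + g) = scaleR c f + scaleR c g"
    by transfer (auto simp: l1_rel_def distrib_left)
  show "scaleR (c + d) f = scaleR c f + scaleR d f"
    by transfer (auto simp: l1_rel_def distrib_right)
  show "scaleR c (scaleR d f) = scaleR (c * d) f"
    by transfer (auto simp: l1_rel_def mult.assoc)
  show "scaleR 1 f = f" by transfer (auto simp: l1_rel_def)
  show "dist f g = norm (f - g)" by (rule dist_l1_def)
  show "sgn f = scaleR (inverse (norm f)) f" by (rule sgn_l1_def)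
  show "uniformity = (INF e\<in>{0<..}. principal {(f, g :: l1). dist f g < e})"
    by (rule uniformity_l1_def)
  show "open U \<longleftrightarrow> (\<forall>f\<in>U. eventually (\<lambda>(f', g). f' = f \<longrightarrow> g \<in> U) uniformity)" for U :: "l1 set"
    by (rule open_l1_def)
  show "norm f = 0 \<longleftrightarrow> f = 0"
  proof (transfer)
    fix f :: "real \<Rightarrow> real"
    assume "l1_rel f f"
    then have f: "integrable lborel f" by (simp add: l1_rel_def)
    have "(LINT x|lborel. \<bar>f x\<bar>) = 0 \<longleftrightarrow> (AE x in lborel. \<bar>f x\<bar> = 0)"
      using f by (intro integral_nonneg_eq_0_iff_AE) auto
    with f show "(LINT x|lborel. \<bar>f x\<bar>) = 0 \<longleftrightarrow> l1_rel f (\<lambda>_. 0)"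
      by (simp add: l1_rel_def)
  qed
  show "norm (f + g) \<le> norm f + norm g"
  proof (transfer)
    fix f g :: "real \<Rightarrow> real"
    assume "l1_rel f f" "l1_rel g g"
    then have i: "integrable lborel f" "integrable lborel g" by (simp_all add: l1_rel_def)
    have "(LINT x|lborel. \<bar>f x + g x\<bar>) \<le> (LINT x|lborel. \<bar>f x\<bar> + \<bar>g x\<bar>)"
      using i by (intro integral_mono) (auto simp: abs_triangle_ineq)
    then show "(LINT x|lborel. \<bar>f x + g x\<bar>) \<le> (LINT x|lborel. \<bar>f x\<bar>) + (LINT x|lborel. \<bar>g x\<bar>)"
      using i by simp
  qed
  show "norm (scaleR c f) = \<bar>c\<bar> * norm f"
    by transfer (simp add: abs_mult)
qed

end

text \<open>
  \<open>L\<^sup>1((a,b))\<close> is identified, via extension by zero, with the closed subspace of the classes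
  in \<open>L\<^sup>1(\<real>)\<close> that vanish almost everywhere outside \<open>(a,b)\<close>.
\<close>

definition L1_interval :: "real \<Rightarrow> real \<Rightarrow> l1 set" where
  "L1_interval a b = {\<rho>. AE x in lborel. x \<notin> {a<..<b} \<longrightarrow> rep_l1 \<rho> x = 0}"


section \<open>Bounded variation and traces\<close>

definition variation_on :: "real set \<Rightarrow> (real \<Rightarrow> real) \<Rightarrow> ennreal" where
  "variation_on I f =
     (SUP xs\<in>{xs. sorted xs \<and> set xs \<subseteq> I}.
        \<Sum>i<length xs - 1. ennreal \<bar>f (xs ! Suc i) - f (xs ! i)\<bar>)"

text \<open>
  The total variation of an almost-everywhere class: the least pointwise variation of a
  representative (the essential variation).
\<close>

definition TV :: "real \<Rightarrow> real \<Rightarrow> (real \<Rightarrow> real) \<Rightarrow> ennreal" where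
  "TV a b f =
     (INF g\<in>{g. AE x in lborel. x \<in> {a<..<b} \<longrightarrow> g x = f x}. variation_on {a<..<b} g)"

definition BV_Tonelli_Cesari ::
  "real \<Rightarrow> real \<Rightarrow> real \<Rightarrow> real \<Rightarrow> (real \<times> real \<Rightarrow> real) \<Rightarrow> bool" where
  "BV_Tonelli_Cesari a b s T u \<longleftrightarrow>
     set_integrable lborel ({a<..<b} \<times> {s<..<T}) u \<and>
     (\<integral>\<^sup>+t\<in>{s<..<T}. TV a b (\<lambda>x. u (x, t)) \<partial>lborel) < \<infinity> \<and>
     (\<integral>\<^sup>+x\<in>{a<..<b}. TV s T (\<lambda>t. u (x, t)) \<partial>lborel) < \<infinity>"

text \<open>
  One-sided limits outside a null set.  They are unique when they exist, depend only on the
  almost-everywhere class, and exist at both end points of \<open>(a,b)\<close> if the variation is finite.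
\<close>

definition trace_right :: "(real \<Rightarrow> real) \<Rightarrow> real \<Rightarrow> real" where
  "trace_right f a = (THE l. \<exists>Z\<in>null_sets lborel. (f \<longlongrightarrow> l) (at a within ({a<..} - Z)))"

definition trace_left :: "(real \<Rightarrow> real) \<Rightarrow> real \<Rightarrow> real" where
  "trace_left f b = (THE l. \<exists>Z\<in>null_sets lborel. (f \<longlongrightarrow> l) (at b within ({..<b} - Z)))"


section \<open>Production networks\<close>

text \<open>
  The arcs \<open>1, \<dots>, N\<close> are the elements of a finite type \<open>'e\<close>, so that \<open>N = CARD('e)\<close>.
\<close>

record ('v, 'e) production_network =
  net :: "('v, 'e) pre_digraph"
  horizon :: real
  lo :: "'e \<Rightarrow> real"
  hi :: "'e \<Rightarrow> real"
  velocity :: "'e \<Rightarrow> real"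
  inflow :: "'v \<Rightarrow> real \<Rightarrow> real"
  distribution :: "'v \<Rightarrow> 'e \<Rightarrow> real \<Rightarrow> real"

definition V_in :: "('v, 'e) production_network \<Rightarrow> 'v set" where
  "V_in P = {v \<in> verts (net P). in_arcs (net P) v = {}}"

definition is_production_network :: "('v, 'e::finite) production_network \<Rightarrow> bool" where
  "is_production_network P \<longleftrightarrow>
     wf_digraph (net P) \<and> arcs (net P) = UNIV \<and> verts (net P) \<noteq> {} \<and>
     horizon P > 0 \<and>
     (\<forall>e. lo P e < hi P e \<and> velocity P e > 0) \<and>
     (\<forall>v\<in>verts (net P). out_arcs (net P) v \<noteq> {} \<longrightarrow>
        (\<forall>t\<in>{0..horizon P}.
           (\<forall>e\<in>out_arcs (net P) v. distribution P v e t \<in> {0..1}) \<and>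
           (\<Sum>e\<in>out_arcs (net P) v. distribution P v e t) = 1))"

type_synonym 'e load = "(real ^ 'e) \<times> (l1 ^ 'e)"

definition load_space :: "('v, 'e::finite) production_network \<Rightarrow> 'e load set" where
  "load_space P = {(q, \<rho>). \<forall>e. 0 \<le> q $ e \<and> \<rho> $ e \<in> L1_interval (lo P e) (hi P e)}"

text \<open>This norm induces the product topology carried by the type \<open>'e load\<close>.\<close>

definition load_norm :: "'e::finite load \<Rightarrow> real" where
  "load_norm u = (\<Sum>e\<in>UNIV. norm (snd u $ e) + \<bar>fst u $ e\<bar>)"

definition BV_load_space :: "('v, 'e::finite) production_network \<Rightarrow> 'e load set" where
  "BV_load_space P =
     {u \<in> load_space P. \<forall>e. TV (lo P e) (hi P e) (rep_l1 (snd u $ e)) < \<infinity>}"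


section \<open>Deterministic dynamics\<close>

definition flux :: "('v, 'e::finite) production_network \<Rightarrow> real ^ 'e \<Rightarrow> 'e \<Rightarrow> real \<Rightarrow> real" where
  "flux P m e \<rho> = min (velocity P e * \<rho>) (m $ e)"

definition g_in ::
  "('v, 'e::finite) production_network \<Rightarrow> real ^ 'e \<Rightarrow> (real \<Rightarrow> 'e load) \<Rightarrow> 'e \<Rightarrow> real \<Rightarrow> real" where
  "g_in P m w e t =
     (let v = tail (net P) e in
      if v \<in> V_in P then inflow P v t
      else distribution P v e t *
        (\<Sum>e'\<in>in_arcs (net P) v. flux P m e' (trace_left (rep_l1 (snd (w t) $ e')) (hi P e'))))"

definition g_out ::
  "('v, 'e::finite) production_network \<Rightarrow> real ^ 'e \<Rightarrow> (real \<Rightarrow> 'e load) \<Rightarrow> 'e \<Rightarrow> real \<Rightarrow> real" where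
  "g_out P m w e t = (if fst (w t) $ e = 0 then min (g_in P m w e t) (m $ e) else m $ e)"

text \<open>
  \<open>test_function a b s T \<phi> D\<close>: \<open>\<phi>\<close> is a nonnegative element of \<open>C\<^sup>2\<^sub>0([a,b) \<times> (s,T))\<close>, and \<open>D\<close> is its
  (at \<open>x = a\<close> one-sided) total derivative, so that \<open>D (x, t) (1, 0)\<close> and \<open>D (x, t) (0, 1)\<close> are the
  partial derivatives in \<open>x\<close> and \<open>t\<close>.
\<close>

definition test_function ::
  "real \<Rightarrow> real \<Rightarrow> real \<Rightarrow> real \<Rightarrow> (real \<times> real \<Rightarrow> real) \<Rightarrow>
   (real \<times> real \<Rightarrow> (real \<times> real) \<Rightarrow>\<^sub>L real) \<Rightarrow> bool" where
  "test_function a b s T \<phi> D \<longleftrightarrow>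
     (let Q = {a..<b} \<times> {s<..<T} in
      (\<forall>z\<in>Q. 0 \<le> \<phi> z) \<and>
      (\<forall>z\<in>Q. (\<phi> has_derivative blinfun_apply (D z)) (at z within Q)) \<and>
      (\<exists>D2. (\<forall>z\<in>Q. (D has_derivative blinfun_apply (D2 z)) (at z within Q)) \<and> continuous_on Q D2) \<and>
      (\<exists>K. compact K \<and> K \<subseteq> Q \<and> (\<forall>z\<in>Q - K. \<phi> z = 0)))"

text \<open>
  A density is a continuous curve \<open>\<rho> : [s,T] \<rightarrow> L\<^sup>1((a,b))\<close>, which makes the initial value
  meaningful; \<open>r\<close> is a jointly measurable representative of it on \<open>(a,b) \<times> (s,T)\<close>.  The argument
  \<open>\<gamma>\<close> is the boundary datum for \<open>\<rho>\<close> at \<open>x = a\<close>.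
\<close>

definition weak_entropy_solution ::
  "real \<Rightarrow> real \<Rightarrow> real \<Rightarrow> real \<Rightarrow> (real \<Rightarrow> real) \<Rightarrow> l1 \<Rightarrow> (real \<Rightarrow> real) \<Rightarrow> (real \<Rightarrow> l1) \<Rightarrow> bool" where
  "weak_entropy_solution a b s T f \<rho>0 \<gamma> \<rho> \<longleftrightarrow>
     (\<forall>t\<in>{s..T}. \<rho> t \<in> L1_interval a b) \<and> continuous_on {s..T} \<rho> \<and> \<rho> s = \<rho>0 \<and>
     (\<exists>r \<in> borel_measurable borel.
        (AE t in lborel. t \<in> {s<..<T} \<longrightarrow>
           (AE x in lborel. x \<in> {a<..<b} \<longrightarrow> r (x, t) = rep_l1 (\<rho> t) x)) \<and>
        BV_Tonelli_Cesari a b s T r \<and>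
        (\<forall>k \<phi> D. test_function a b s T \<phi> D \<longrightarrow>
           (LINT z:{a<..<b} \<times> {s<..<T}|lborel.
              \<bar>r z - k\<bar> * D z (0, 1) + sgn (r z - k) * (f (r z) - f k) * D z (1, 0))
           \<ge> - (LINT t:{s<..<T}|lebesgue.
                  sgn (\<gamma> t - k) * (f (trace_right (rep_l1 (\<rho> t)) a) - f k) * \<phi> (a, t))))"

definition network_solution ::
  "('v, 'e::finite) production_network \<Rightarrow> real ^ 'e \<Rightarrow> real \<Rightarrow> 'e load \<Rightarrow> (real \<Rightarrow> 'e load) \<Rightarrow> bool" where
  "network_solution P m s u w \<longleftrightarrow>
     (\<forall>t\<in>{s..horizon P}. w t \<in> load_space P) \<and>
     (\<forall>e. (\<lambda>t. g_in P m w e t - g_out P m w e t) absolutely_integrable_on {s..horizon P} \<and>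
          (\<forall>t\<in>{s..horizon P}.
             fst (w t) $ e =
               fst u $ e + (LINT \<tau>:{s..t}|lebesgue. g_in P m w e \<tau> - g_out P m w e \<tau>))) \<and>
     (\<forall>e. weak_entropy_solution (lo P e) (hi P e) s (horizon P) (flux P m e) (snd u $ e)
            (\<lambda>t. g_out P m w e t / velocity P e) (\<lambda>t. snd (w t) $ e))"

definition solution_operator ::
  "('v, 'e::finite) production_network \<Rightarrow> real ^ 'e \<Rightarrow>
   (real \<Rightarrow> real \<Rightarrow> 'e load \<Rightarrow> 'e load) \<Rightarrow> bool" where
  "solution_operator P m S \<longleftrightarrow>
     (\<forall>s t. 0 \<le> s \<and> s \<le> t \<and> t \<le> horizon P \<longrightarrow> S s t \<in> load_space P \<rightarrow> load_space P) \<and>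
     (\<forall>s\<in>{0..horizon P}. \<forall>u\<in>load_space P. S s s u = u) \<and>
     (\<forall>s t t'. 0 \<le> s \<and> s \<le> t \<and> t \<le> t' \<and> t' \<le> horizon P \<longrightarrow>
        (\<forall>u\<in>load_space P. S s t' u = S t t' (S s t u))) \<and>
     (\<forall>s\<in>{0..horizon P}. \<forall>u\<in>load_space P. continuous_on {s..horizon P} (\<lambda>t. S s t u)) \<and>
     (\<forall>s t. 0 \<le> s \<and> s \<le> t \<and> t \<le> horizon P \<longrightarrow>
        (\<forall>u\<in>load_space P. \<forall>u'\<in>load_space P.
           load_norm (S s t u - S s t u') \<le> load_norm (u - u'))) \<and>
     (\<forall>s\<in>{0..horizon P}. \<forall>u\<in>BV_load_space P.
        network_solution P m s u (\<lambda>t. S s t u) \<and>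
        (\<forall>w. network_solution P m s u w \<longrightarrow> (\<forall>t\<in>{s..horizon P}. w t = S s t u)) \<and>
        (\<forall>t\<in>{s..horizon P}. S s t u \<in> BV_load_space P)) \<and>
     (\<forall>u\<in>BV_load_space P. \<exists>L>0. \<forall>s\<in>{0..horizon P}.
        \<forall>t\<in>{s..horizon P}. \<forall>t'\<in>{s..horizon P}.
          load_norm (S s t u - S s t' u) \<le> L * \<bar>t - t'\<bar>)"


section \<open>The stochastic model\<close>

type_synonym 'e state = "(nat ^ 'e) \<times> 'e load"

definition state_space ::
  "('v, 'e::finite) production_network \<Rightarrow> ('e \<Rightarrow> nat) \<Rightarrow> 'e state set" where
  "state_space P C = {r. \<forall>e. r $ e \<in> {1..C e}} \<times> load_space P"

definition state_measure ::
  "('v, 'e::finite) production_network \<Rightarrow> ('e \<Rightarrow> nat) \<Rightarrow> 'e state measure" where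
  "state_measure P C = restrict_space borel (state_space P C)"

definition cond_prob_wrt :: "'w measure \<Rightarrow> 'w measure \<Rightarrow> 'w set \<Rightarrow> 'w \<Rightarrow> real" where
  "cond_prob_wrt M F A = real_cond_exp M F (indicator A)"

definition natural_filtration ::
  "'w measure \<Rightarrow> 's measure \<Rightarrow> (real \<Rightarrow> 'w \<Rightarrow> 's) \<Rightarrow> real \<Rightarrow> 'w measure" where
  "natural_filtration M K X t =
     sigma (space M) (\<Union>u\<in>{0..t}. {X u -` B \<inter> space M | B. B \<in> sets K})"

definition markov_process ::
  "'w measure \<Rightarrow> 's measure \<Rightarrow> real \<Rightarrow> (real \<Rightarrow> 'w \<Rightarrow> 's) \<Rightarrow> bool" where
  "markov_process M K T X \<longleftrightarrow>
     (\<forall>s t. 0 \<le> s \<and> s \<le> t \<and> t \<le> T \<longrightarrow> (\<forall>B\<in>sets K. AE \<omega> in M.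
        cond_prob_wrt M (natural_filtration M K X s) (X t -` B \<inter> space M) \<omega> =
        cond_prob_wrt M (vimage_algebra (space M) (X s) K) (X t -` B \<inter> space M) \<omega>))"

definition transition_function ::
  "'w measure \<Rightarrow> 's measure \<Rightarrow> real \<Rightarrow> (real \<Rightarrow> 'w \<Rightarrow> 's) \<Rightarrow>
   (real \<Rightarrow> real \<Rightarrow> 's \<Rightarrow> 's measure) \<Rightarrow> bool" where
  "transition_function M K T X p \<longleftrightarrow>
     (\<forall>s t. 0 \<le> s \<and> s \<le> t \<and> t \<le> T \<longrightarrow>
        p s t \<in> K \<rightarrow>\<^sub>M prob_algebra K \<and>
        (\<forall>B\<in>sets K. AE \<omega> in M.
           cond_prob_wrt M (vimage_algebra (space M) (X s) K) (X t -` B \<inter> space M) \<omega> =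
           measure (p s t (X s \<omega>)) B)) \<and>
     (\<forall>s t u. 0 \<le> s \<and> s \<le> t \<and> t \<le> u \<and> u \<le> T \<longrightarrow>
        (\<forall>x\<in>space K. p s u x = p s t x \<bind> p t u))"

definition capacity_vector :: "('e::finite \<Rightarrow> nat \<Rightarrow> real) \<Rightarrow> nat ^ 'e \<Rightarrow> real ^ 'e" where
  "capacity_vector \<mu> r = (\<chi> e. \<mu> e (r $ e))"

text \<open>
  \<open>S m s t\<close> is the solution operator from time \<open>s\<close> to time \<open>t\<close> for the constant capacities \<open>m\<close>,
  and \<open>rate e i j t q \<rho>\<close> is the rate of the transition from \<open>i\<close> to \<open>j\<close> at arc \<open>e\<close>
  (for \<open>i = j\<close>: the total rate of leaving \<open>i\<close>).
\<close>

definition MLDPNM ::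
  "('v, 'e::finite) production_network \<Rightarrow>
   (real ^ 'e \<Rightarrow> real \<Rightarrow> real \<Rightarrow> 'e load \<Rightarrow> 'e load) \<Rightarrow>
   ('e \<Rightarrow> nat) \<Rightarrow> ('e \<Rightarrow> nat \<Rightarrow> nat \<Rightarrow> real \<Rightarrow> real \<Rightarrow> l1 \<Rightarrow> real) \<Rightarrow> ('e \<Rightarrow> nat \<Rightarrow> real) \<Rightarrow>
   'e state \<Rightarrow> 'w measure \<Rightarrow> (real \<Rightarrow> 'w \<Rightarrow> 'e state) \<Rightarrow> bool" where
  "MLDPNM P S C rate \<mu> x0 M X \<longleftrightarrow>
     (let T = horizon P; K = state_measure P C in
      prob_space M \<and> (\<forall>t\<in>{0..T}. X t \<in> M \<rightarrow>\<^sub>M K) \<and>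
      (AE \<omega> in M. X 0 \<omega> = x0) \<and>
      markov_process M K T X \<and>
      (\<exists>p. transition_function M K T X p \<and>
        (\<forall>t\<in>{0<..<T}. \<forall>(r, q, \<rho>)\<in>state_space P C. \<forall>e. \<forall>j\<in>{1..C e}.
          (\<lambda>\<Delta>. measure (p t (t + \<Delta>) (r, q, \<rho>)) {y \<in> space K. fst y $ e = j} -
                ((1 - \<Delta> * rate e (r $ e) (r $ e) t (q $ e) (\<rho> $ e)) * of_bool (j = r $ e) +
                 \<Delta> * rate e (r $ e) j t (q $ e) (\<rho> $ e) * of_bool (j \<noteq> r $ e)))
          \<in> o[at_right 0](\<lambda>\<Delta>. \<Delta>))) \<and>
      (\<exists>Z\<in>null_sets M. \<forall>\<omega>\<in>space M - Z. \<exists>n (\<theta> :: nat \<Rightarrow> real).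
        \<theta> 0 = 0 \<and> \<theta> n = T \<and> (\<forall>k<n. \<theta> k \<le> \<theta> (Suc k)) \<and>
        (\<forall>k<n.
          (\<lambda>t. capacity_vector \<mu> (fst (X t \<omega>))) constant_on {\<theta> k..<\<theta> (Suc k)} \<and>
          (\<forall>t\<in>{\<theta> k..<\<theta> (Suc k)}.
            snd (X t \<omega>) =
            S (capacity_vector \<mu> (fst (X (\<theta> k) \<omega>))) (\<theta> k) t (snd (X (\<theta> k) \<omega>))))))"

end

theory Submission
  imports Defs
begin

text \<open>
  The process is obtained by thinning a Poisson clock whose rate dominates all jump rates.  At every
  tick an independent uniform mark proposes a change of one level and decides whether it is accepted;
  between ticks the load follows the solution operator.  Since the exponential law is memoryless, the
  noise remaining after time \<open>t\<close> is independent of the state at \<open>t\<close> and again a fresh noise,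
  and the path after \<open>t\<close> is the same functional of the two.  This gives the Markov property
  and the Chapman--Kolmogorov equations from every starting point, and the rates follow because two
  ticks within time \<open>\<Delta>\<close> have probability \<open>O(\<Delta>\<^sup>2)\<close>.
\<close>

section \<open>Deterministic flows interrupted by a marked Poisson clock\<close>

text \<open>The rate condition is demanded at every state, also at states that the process never
  reaches. A version of the conditional law, fixed only up to null sets, therefore cannot serve as
  transition function. This is why the process is built from every time and every state with one
  common noise, and why the kernel is defined as its law. The rates depend on a load that moves
  between jumps. Candidate times that ignore the state remove this difficulty: that ticks do not
  accumulate, and that the noise renews itself, are statements about i.i.d. pairs alone.
  Independence is expressed as an identity between nonnegative integrals, restricted to exactly n
  ticks up to the time considered. It is proved by induction on n, peeling off one pair at a time;
  the exponential law matters there only for n = 0, where a gap is cut in two. Conditional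
  expectations appear only at the end, when the identity is brought into the required form.\<close>

lemma nn_integral_exponential_memoryless:
  fixes g :: "real \<Rightarrow> ennreal"
  assumes [measurable]: "g \<in> borel_measurable borel" and l: "0 < l" and c: "0 \<le> c"
  shows "(\<integral>\<^sup>+\<xi>. (if c < \<xi> then g (\<xi> - c) else 0) \<partial>density lborel (exponential_density l)) =
    ennreal (exp (- l * c)) * (\<integral>\<^sup>+\<xi>. g \<xi> \<partial>density lborel (exponential_density l))"
proof -
  have "(\<integral>\<^sup>+\<xi>. (if c < \<xi> then g (\<xi> - c) else 0) \<partial>density lborel (exponential_density l)) =
     (\<integral>\<^sup>+\<xi>. exponential_density l \<xi> * (if c < \<xi> then g (\<xi> - c) else 0) \<partial>lborel)"
    by (subst nn_integral_density) auto
  also have "\<dots> = (\<integral>\<^sup>+y. exponential_density l (c + y) * (if 0 < y then g y else 0) \<partial>lborel)"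
    by (subst nn_integral_real_affine[where c=1 and t=c]) (auto intro!: nn_integral_cong)
  also have "\<dots> = (\<integral>\<^sup>+y. ennreal (exp (- l * c)) * (exponential_density l y * g y) \<partial>lborel)"
  proof (intro nn_integral_cong_AE)
    \<comment> \<open>The two sides may differ at y = 0, where the density is positive but the
      strict condition fails; one point is null.\<close>
    show "AE y in lborel. exponential_density l (c + y) * (if 0 < y then g y else 0) =
        ennreal (exp (- l * c)) * (exponential_density l y * g y)"
      using AE_lborel_singleton[of 0]
    proof eventually_elim
      case (elim y)
      show ?case
      proof (cases "0 < y")
        case True
        then have "exponential_density l (c + y) = exp (- l * c) * exponential_density l y"
          using c by (simp add: exponential_density_def exp_add[symmetric] algebra_simps)
        then show ?thesis
          using True l by (simp add: ennreal_mult exponential_density_nonneg mult.assoc)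
      qed (use elim l in \<open>simp add: exponential_density_def\<close>)
    qed
  qed
  also have "\<dots> = ennreal (exp (- l * c)) * (\<integral>\<^sup>+\<xi>. g \<xi> \<partial>density lborel (exponential_density l))"
    by (subst nn_integral_density) (auto simp: nn_integral_cmult)
  finally show ?thesis .
qed

text \<open>\<open>\<Phi> s t x\<close> is the state at time t of the undisturbed motion through x
  at time s, and \<open>J t x m\<close> the state into which a tick at time t with mark m throws x.
  K is an abstract measurable space: neither a topology nor a network enters, and the flow need only
  be measurable jointly in its times and the state.\<close>

locale jump_flow =
  fixes K :: "'s measure" and Q :: "real measure" and l :: real
    and \<Phi> :: "real \<Rightarrow> real \<Rightarrow> 's \<Rightarrow> 's" and J :: "real \<Rightarrow> 's \<Rightarrow> real \<Rightarrow> 's"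
  assumes prob_Q: "prob_space Q" and sets_Q [measurable_cong]: "sets Q = sets borel"
    and l_pos: "0 < l"
    and flow_measurable: "(\<lambda>(s, t, x). \<Phi> s t x) \<in> borel \<Otimes>\<^sub>M borel \<Otimes>\<^sub>M K \<rightarrow>\<^sub>M K"
    and jump_measurable: "(\<lambda>(t, x, m). J t x m) \<in> borel \<Otimes>\<^sub>M K \<Otimes>\<^sub>M borel \<rightarrow>\<^sub>M K"
    and flow_flow: "\<And>s t u x. x \<in> space K \<Longrightarrow> s \<le> t \<Longrightarrow> t \<le> u \<Longrightarrow> \<Phi> t u (\<Phi> s t x) = \<Phi> s u x"
    and flow_refl: "\<And>s x. x \<in> space K \<Longrightarrow> \<Phi> s s x = x"
begin

section \<open>The noise: independent pairs of an exponential gap and a mark\<close>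

abbreviation expo :: "real measure" where
  "expo \<equiv> density lborel (exponential_density l)"

definition \<nu> :: "(real \<times> real) measure" where
  "\<nu> = expo \<Otimes>\<^sub>M Q"

definition \<Omega> :: "(real \<times> real) stream measure" where
  "\<Omega> = stream_space \<nu>"

sublocale Q: prob_space Q by (rule prob_Q)
sublocale expo: prob_space expo by (rule prob_space_exponential_density[OF l_pos])
sublocale expo_Q: pair_prob_space expo Q ..
sublocale \<nu>: prob_space \<nu> unfolding \<nu>_def by (rule expo_Q.prob_space_axioms)
sublocale \<Omega>: prob_space \<Omega> unfolding \<Omega>_def by (rule \<nu>.prob_space_stream_space)

lemma sets_\<nu> [measurable_cong]: "sets \<nu> = sets (borel \<Otimes>\<^sub>M borel)"
  unfolding \<nu>_def by (intro sets_pair_measure_cong) (simp_all add: sets_Q)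

lemma space_Q: "space Q = UNIV"
  using sets_eq_imp_space_eq[OF sets_Q] by simp

lemma space_\<nu>: "space \<nu> = UNIV"
  using sets_eq_imp_space_eq[OF sets_\<nu>] by (simp add: space_pair_measure)

lemma space_\<Omega>: "space \<Omega> = UNIV"
  by (simp add: \<Omega>_def space_stream_space space_\<nu>)

lemma measurable_shd_\<Omega> [measurable]: "shd \<in> \<Omega> \<rightarrow>\<^sub>M borel \<Otimes>\<^sub>M borel"
  using measurable_shd[of \<nu>] unfolding \<Omega>_def by (simp cong: measurable_cong_sets add: sets_\<nu>)

lemma measurable_stl_\<Omega> [measurable]: "stl \<in> \<Omega> \<rightarrow>\<^sub>M \<Omega>"
  unfolding \<Omega>_def by measurable

lemma measurable_Stream_\<Omega> [measurable (raw)]: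
  assumes "f \<in> N \<rightarrow>\<^sub>M borel \<Otimes>\<^sub>M borel" "g \<in> N \<rightarrow>\<^sub>M \<Omega>"
  shows "(\<lambda>x. f x ## g x) \<in> N \<rightarrow>\<^sub>M \<Omega>"
  using assms unfolding \<Omega>_def
  by (intro measurable_Stream) (simp_all cong: measurable_cong_sets add: sets_\<nu>)

lemma measurable_flow [measurable (raw)]:
  assumes [measurable]: "f \<in> N \<rightarrow>\<^sub>M borel" "g \<in> N \<rightarrow>\<^sub>M borel" "h \<in> N \<rightarrow>\<^sub>M K"
  shows "(\<lambda>w. \<Phi> (f w) (g w) (h w)) \<in> N \<rightarrow>\<^sub>M K"
  using measurable_compose[OF _ flow_measurable, of "\<lambda>w. (f w, g w, h w)" N] by simp

lemma measurable_jump [measurable (raw)]: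
  assumes [measurable]: "f \<in> N \<rightarrow>\<^sub>M borel" "g \<in> N \<rightarrow>\<^sub>M K" "h \<in> N \<rightarrow>\<^sub>M borel"
  shows "(\<lambda>w. J (f w) (g w) (h w)) \<in> N \<rightarrow>\<^sub>M K"
  using measurable_compose[OF _ jump_measurable, of "\<lambda>w. (f w, g w, h w)" N] by simp

lemma flow_in_space [simp]: "x \<in> space K \<Longrightarrow> \<Phi> s t x \<in> space K"
  using measurable_space[OF flow_measurable, of "(s, t, x)"] by (simp add: space_pair_measure)

lemma jump_in_space [simp]: "x \<in> space K \<Longrightarrow> J t x m \<in> space K"
  using measurable_space[OF jump_measurable, of "(t, x, m)"] by (simp add: space_pair_measure)

lemma nn_integral_\<Omega>:
  assumes [measurable]: "f \<in> borel_measurable \<Omega>"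
  shows "(\<integral>\<^sup>+\<omega>. f \<omega> \<partial>\<Omega>) = (\<integral>\<^sup>+z. (\<integral>\<^sup>+\<omega>. f (z ## \<omega>) \<partial>\<Omega>) \<partial>\<nu>)"
  using \<nu>.nn_integral_stream_space[of f] assms unfolding \<Omega>_def by simp

text \<open>The gap is the inner variable, with the mark frozen, so that
  \<open>nn_integral_exponential_memoryless\<close> applies to the inner integral.\<close>

lemma nn_integral_\<nu>:
  assumes [measurable]: "f \<in> borel_measurable (borel \<Otimes>\<^sub>M borel)"
  shows "(\<integral>\<^sup>+z. f z \<partial>\<nu>) = (\<integral>\<^sup>+m. (\<integral>\<^sup>+\<xi>. f (\<xi>, m) \<partial>expo) \<partial>Q)"
  unfolding \<nu>_def by (subst expo_Q.nn_integral_snd[symmetric]) simp_all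

text \<open>
  The noise is a stream of pairs (gap to the next clock tick, mark).  \<open>cnt n c \<omega>\<close> says that exactly \<open>n\<close>
  ticks occur up to time \<open>c\<close>; \<open>resid n c \<omega>\<close> is the noise remaining after \<open>c\<close> and \<open>path n s x \<omega> t\<close> the state
  at \<open>t\<close>, started at time \<open>s\<close> in \<open>x\<close>, both provided that there were exactly \<open>n\<close> ticks.
\<close>

primrec cnt :: "nat \<Rightarrow> real \<Rightarrow> (real \<times> real) stream \<Rightarrow> bool" where
  "cnt 0 c \<omega> \<longleftrightarrow> c < fst (shd \<omega>)"
| "cnt (Suc n) c \<omega> \<longleftrightarrow> fst (shd \<omega>) \<le> c \<and> cnt n (c - fst (shd \<omega>)) (stl \<omega>)"

primrec resid :: "nat \<Rightarrow> real \<Rightarrow> (real \<times> real) stream \<Rightarrow> (real \<times> real) stream" where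
  "resid 0 c \<omega> = (fst (shd \<omega>) - c, snd (shd \<omega>)) ## stl \<omega>"
| "resid (Suc n) c \<omega> = resid n (c - fst (shd \<omega>)) (stl \<omega>)"

primrec path :: "nat \<Rightarrow> real \<Rightarrow> 's \<Rightarrow> (real \<times> real) stream \<Rightarrow> real \<Rightarrow> 's" where
  "path 0 s x \<omega> t = \<Phi> s t x"
| "path (Suc n) s x \<omega> t =
    path n (s + fst (shd \<omega>)) (J (s + fst (shd \<omega>)) (\<Phi> s (s + fst (shd \<omega>)) x) (snd (shd \<omega>))) (stl \<omega>) t"

lemma measurable_cnt [measurable (raw)]:
  assumes "f \<in> N \<rightarrow>\<^sub>M borel" "g \<in> N \<rightarrow>\<^sub>M \<Omega>"
  shows "Measurable.pred N (\<lambda>w. cnt n (f w) (g w))"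
  using assms
proof (induction n arbitrary: f g)
  case 0
  note [measurable] = 0
  show ?case by simp
next
  case (Suc n)
  note [measurable] = Suc.prems
  have [measurable]: "Measurable.pred N (\<lambda>w. cnt n (f w - fst (shd (g w))) (stl (g w)))"
    by (rule Suc.IH) measurable
  show ?case by simp
qed

lemma measurable_resid [measurable (raw)]:
  assumes "f \<in> N \<rightarrow>\<^sub>M borel" "g \<in> N \<rightarrow>\<^sub>M \<Omega>"
  shows "(\<lambda>w. resid n (f w) (g w)) \<in> N \<rightarrow>\<^sub>M \<Omega>"
  using assms
proof (induction n arbitrary: f g)
  case 0
  note [measurable] = 0
  show ?case by simp
next
  case (Suc n)
  note [measurable] = Suc.prems
  show ?case unfolding resid.simps by (rule Suc.IH) measurable
qed

lemma measurable_path [measurable (raw)]: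
  assumes "f \<in> N \<rightarrow>\<^sub>M borel" "h \<in> N \<rightarrow>\<^sub>M K" "g \<in> N \<rightarrow>\<^sub>M \<Omega>" "k \<in> N \<rightarrow>\<^sub>M borel"
  shows "(\<lambda>w. path n (f w) (h w) (g w) (k w)) \<in> N \<rightarrow>\<^sub>M K"
  using assms
proof (induction n arbitrary: f g h k)
  case 0
  note [measurable] = 0
  show ?case by simp
next
  case (Suc n)
  note [measurable] = Suc.prems
  show ?case unfolding path.simps by (rule Suc.IH) measurable
qed

lemma path_in_space [simp]: "x \<in> space K \<Longrightarrow> path n s x \<omega> t \<in> space K"
  by (induction n arbitrary: s x \<omega>) simp_all

lemma cnt_unique: "cnt n c \<omega> \<Longrightarrow> cnt k c \<omega> \<Longrightarrow> n = k"
proof (induction n arbitrary: k c \<omega>)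
  case 0
  then show ?case by (cases k) auto
next
  case (Suc n)
  then show ?case by (cases k) auto
qed

text \<open>Discarding the time up to t shortens only the gap in progress, so later ticks keep their
  absolute times and marks. The two computations then differ only in whether the flow up to the next
  tick, or up to u, is interrupted at t, which \<open>flow_flow\<close> makes immaterial.\<close>

lemma cocycle:
  assumes "x \<in> space K" "s \<le> t" "t \<le> u" "cnt n (t - s) \<omega>" "cnt k (u - t) (resid n (t - s) \<omega>)"
  shows "cnt (n + k) (u - s) \<omega> \<and>
    path (n + k) s x \<omega> u = path k t (path n s x \<omega> t) (resid n (t - s) \<omega>) u"
  using assms
proof (induction n arbitrary: s x \<omega>)
  case 0
  obtain \<xi> m \<omega>' where \<omega>: "\<omega> = (\<xi>, m) ## \<omega>'" by (metis stream.exhaust surj_pair)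
  show ?case
  proof (cases k)
    case 0
    with "0.prems" \<omega> show ?thesis by (simp add: flow_flow)
  next
    case (Suc k')
    \<comment> \<open>The pending tick falls at s + \<xi>, which is not before t; the shortened gap,
      counted from t, leads to the same instant.\<close>
    have "t \<le> s + \<xi>" using 0 \<omega> by simp
    then show ?thesis
      using "0.prems" \<omega> Suc by (simp add: flow_flow algebra_simps)
  qed
next
  case (Suc n)
  obtain \<xi> m \<omega>' where \<omega>: "\<omega> = (\<xi>, m) ## \<omega>'" by (metis stream.exhaust surj_pair)
  have e: "t - (s + \<xi>) = t - s - \<xi>" "u - (s + \<xi>) = u - s - \<xi>" by simp_all
  show ?case
    using Suc.IH[of "J (s + \<xi>) (\<Phi> s (s + \<xi>) x) m" "s + \<xi>" \<omega>'] Suc.prems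
    unfolding e \<omega> by simp
qed

text \<open>Since G is arbitrary, this gives at once that, on the event of n ticks, the residual
  noise is independent of the state at t and distributed as \<open>\<Omega>\<close>. A first tick
  before t restarts the claim with one tick fewer from a later time and a new state, hence s and x
  vary in the induction.\<close>

lemma regeneration_cnt:
  assumes [measurable]: "(\<lambda>(y, \<omega>). G y \<omega>) \<in> borel_measurable (K \<Otimes>\<^sub>M \<Omega>)"
    and "x \<in> space K" "s \<le> t"
  shows "(\<integral>\<^sup>+\<omega>. (if cnt n (t - s) \<omega> then G (path n s x \<omega> t) (resid n (t - s) \<omega>) else 0) \<partial>\<Omega>) =
    (\<integral>\<^sup>+\<omega>. (if cnt n (t - s) \<omega> then \<integral>\<^sup>+\<omega>'. G (path n s x \<omega> t) \<omega>' \<partial>\<Omega> else 0) \<partial>\<Omega>)"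
  using assms(2,3)
proof (induction n arbitrary: s x)
  case 0
  note [simp] = 0
  let ?y = "\<Phi> s t x"
  have [measurable]: "(\<lambda>w. G (\<Phi> s t x) w) \<in> borel_measurable \<Omega>"
    by measurable
  define c where "c = t - s"
  have c: "0 \<le> c" using 0 by (simp add: c_def)
  let ?g = "\<lambda>\<xi> m. \<integral>\<^sup>+\<omega>. G ?y ((\<xi>, m) ## \<omega>) \<partial>\<Omega>"
  have 1: "(\<integral>\<^sup>+\<omega>. (if c < fst (shd \<omega>) then h \<omega> else 0) \<partial>\<Omega>) =
      (\<integral>\<^sup>+m. (\<integral>\<^sup>+\<xi>. (if c < \<xi> then \<integral>\<^sup>+\<omega>. h ((\<xi>, m) ## \<omega>) \<partial>\<Omega> else 0) \<partial>expo) \<partial>Q)"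
    if [measurable]: "h \<in> borel_measurable \<Omega>" for h
    by (subst nn_integral_\<Omega>, simp, subst nn_integral_\<nu>, simp) (auto intro!: nn_integral_cong)
  have 2: "(\<integral>\<^sup>+\<omega>. G ?y \<omega> \<partial>\<Omega>) = (\<integral>\<^sup>+m. (\<integral>\<^sup>+\<xi>. ?g \<xi> m \<partial>expo) \<partial>Q)"
    by (subst nn_integral_\<Omega>, simp, subst nn_integral_\<nu>, simp) (auto intro!: nn_integral_cong)
  have "(\<integral>\<^sup>+\<omega>. (if c < fst (shd \<omega>) then G ?y ((fst (shd \<omega>) - c, snd (shd \<omega>)) ## stl \<omega>) else 0) \<partial>\<Omega>) =
     (\<integral>\<^sup>+m. (\<integral>\<^sup>+\<xi>. (if c < \<xi> then ?g (\<xi> - c) m else 0) \<partial>expo) \<partial>Q)"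
    by (subst 1) (auto intro!: nn_integral_cong)
  also have "\<dots> = (\<integral>\<^sup>+m. ennreal (exp (- l * c)) * (\<integral>\<^sup>+\<xi>. ?g \<xi> m \<partial>expo) \<partial>Q)"
    by (intro nn_integral_cong nn_integral_exponential_memoryless[OF _ l_pos c]) measurable
  also have "\<dots> = ennreal (exp (- l * c)) * (\<integral>\<^sup>+\<omega>. G ?y \<omega> \<partial>\<Omega>)"
    unfolding 2 by (rule nn_integral_cmult) simp
  \<comment> \<open>The left-hand side has become the probability of no tick times the integral over
    a fresh noise. From this value the right-hand side is reached by reading the memoryless lemma
    backwards for a constant integrand.\<close>
  also have "\<dots> = (\<integral>\<^sup>+m. ennreal (exp (- l * c)) * (\<integral>\<^sup>+\<xi>. (\<integral>\<^sup>+\<omega>. G ?y \<omega> \<partial>\<Omega>) \<partial>expo) \<partial>Q)"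
    using expo.emeasure_space_1 by (simp add: Q.emeasure_space_1)
  also have "\<dots> = (\<integral>\<^sup>+m. (\<integral>\<^sup>+\<xi>. (if c < \<xi> then (\<integral>\<^sup>+\<omega>. G ?y \<omega> \<partial>\<Omega>) else 0) \<partial>expo) \<partial>Q)"
    by (intro nn_integral_cong nn_integral_exponential_memoryless[OF _ l_pos c, symmetric]) measurable
  also have "\<dots> = (\<integral>\<^sup>+\<omega>. (if c < fst (shd \<omega>) then (\<integral>\<^sup>+\<omega>. G ?y \<omega> \<partial>\<Omega>) else 0) \<partial>\<Omega>)"
    by (subst 1) (auto simp: \<Omega>.emeasure_space_1 Q.emeasure_space_1 intro!: arg_cong2[where f="(*)"] nn_integral_cong)
  finally show ?case by (simp add: c_def cong: if_cong)
next
  case (Suc n)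
  note [simp] = Suc.prems
  define y where "y \<xi> m = J (s + \<xi>) (\<Phi> s (s + \<xi>) x) m" for \<xi> m
  have [simp]: "y \<xi> m \<in> space K" for \<xi> m by (simp add: y_def)
  have [measurable]: "(\<lambda>w. y (f w) (g w)) \<in> N \<rightarrow>\<^sub>M K"
    if [measurable]: "f \<in> borel_measurable N" "g \<in> borel_measurable N" for f g and N :: "'n measure"
    unfolding y_def by measurable
  have e: "t - s - \<xi> = t - (s + \<xi>)" for \<xi> by simp
  have "(\<integral>\<^sup>+\<omega>. (if cnt (Suc n) (t - s) \<omega> then G (path (Suc n) s x \<omega> t) (resid (Suc n) (t - s) \<omega>) else 0) \<partial>\<Omega>)
      = (\<integral>\<^sup>+z. (if fst z \<le> t - s then \<integral>\<^sup>+\<omega>. (if cnt n (t - (s + fst z)) \<omega>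
          then G (path n (s + fst z) (y (fst z) (snd z)) \<omega> t) (resid n (t - (s + fst z)) \<omega>) else 0) \<partial>\<Omega>
          else 0) \<partial>\<nu>)"
    by (subst nn_integral_\<Omega>) (auto simp: e y_def[symmetric] intro!: nn_integral_cong)
  also have "\<dots> = (\<integral>\<^sup>+z. (if fst z \<le> t - s then \<integral>\<^sup>+\<omega>. (if cnt n (t - (s + fst z)) \<omega>
          then \<integral>\<^sup>+\<omega>'. G (path n (s + fst z) (y (fst z) (snd z)) \<omega> t) \<omega>' \<partial>\<Omega> else 0) \<partial>\<Omega>
          else 0) \<partial>\<nu>)"
    by (intro nn_integral_cong) (simp add: Suc.IH)
  also have "\<dots> = (\<integral>\<^sup>+\<omega>. (if cnt (Suc n) (t - s) \<omega> then
      \<integral>\<^sup>+\<omega>'. G (path (Suc n) s x \<omega> t) \<omega>' \<partial>\<Omega> else 0) \<partial>\<Omega>)"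
    by (subst nn_integral_\<Omega>) (auto simp: e y_def[symmetric] intro!: nn_integral_cong)
  finally show ?case .
qed

section \<open>Ticks do not accumulate\<close>

lemma nn_integral_exp_gap:
  "(\<integral>\<^sup>+z. ennreal (exp (- fst z)) \<partial>\<nu>) = ennreal (l / (l + 1))"
proof -
  interpret e: prob_space "density lborel (exponential_density (l + 1))"
    using l_pos by (intro prob_space_exponential_density) simp
  \<comment> \<open>Multiplying by exp(- \<xi>) turns the rate l into l + 1 up to a factor. That
    factor is the integral sought, because the density with rate l + 1 has mass one.\<close>
  have tilt: "exponential_density l \<xi> * exp (- \<xi>) = l / (l + 1) * exponential_density (l + 1) \<xi>" for \<xi>
    using l_pos by (simp add: exponential_density_def exp_add[symmetric] algebra_simps)
      (simp add: mult_exp_exp field_simps)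
  have "(\<integral>\<^sup>+z. ennreal (exp (- fst z)) \<partial>\<nu>) = (\<integral>\<^sup>+\<xi>. ennreal (exp (- \<xi>)) \<partial>expo)"
    by (subst nn_integral_\<nu>) (simp_all add: Q.emeasure_space_1)
  also have "\<dots> = (\<integral>\<^sup>+\<xi>. ennreal (l / (l + 1)) * (exponential_density (l + 1) \<xi> * 1) \<partial>lborel)"
    using l_pos by (subst nn_integral_density)
      (auto intro!: nn_integral_cong simp: ennreal_mult'[symmetric] exponential_density_nonneg tilt)
  also have "\<dots> = ennreal (l / (l + 1)) * (\<integral>\<^sup>+\<xi>. 1 \<partial>density lborel (exponential_density (l + 1)))"
    by (subst nn_integral_density) (auto simp: nn_integral_cmult)
  finally show ?thesis using e.emeasure_space_1 by simp
qed

definition jump_time :: "nat \<Rightarrow> (real \<times> real) stream \<Rightarrow> real" where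
  "jump_time n \<omega> = (\<Sum>i<n. fst (\<omega> !! i))"

lemma jump_time_0 [simp]: "jump_time 0 \<omega> = 0"
  by (simp add: jump_time_def)

lemma jump_time_Suc: "jump_time (Suc n) \<omega> = fst (shd \<omega>) + jump_time n (stl \<omega>)"
  by (simp add: jump_time_def sum.lessThan_Suc_shift del: sum.lessThan_Suc)

lemma measurable_jump_time [measurable]: "jump_time n \<in> borel_measurable \<Omega>"
proof (induction n)
  case (Suc n)
  note [measurable] = this
  show ?case unfolding jump_time_Suc[abs_def] by measurable
qed (simp add: jump_time_def[abs_def])

lemma nn_integral_exp_jump_time:
  "(\<integral>\<^sup>+\<omega>. ennreal (exp (- jump_time n \<omega>)) \<partial>\<Omega>) = ennreal ((l / (l + 1)) ^ n)"
proof (induction n)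
  case 0
  show ?case by (simp add: \<Omega>.emeasure_space_1)
next
  case (Suc n)
  have "(\<integral>\<^sup>+\<omega>. ennreal (exp (- jump_time (Suc n) \<omega>)) \<partial>\<Omega>) =
    (\<integral>\<^sup>+z. ennreal (exp (- fst z)) * (\<integral>\<^sup>+\<omega>. ennreal (exp (- jump_time n \<omega>)) \<partial>\<Omega>) \<partial>\<nu>)"
    by (subst nn_integral_\<Omega>, simp, subst nn_integral_cmult[symmetric])
      (simp_all add: jump_time_Suc ennreal_mult[symmetric] exp_add[symmetric] algebra_simps)
  also have "\<dots> = ennreal (l / (l + 1)) * ennreal ((l / (l + 1)) ^ n)"
    by (simp add: Suc nn_integral_multc nn_integral_exp_gap)
  finally show ?case using l_pos by (simp add: ennreal_mult[symmetric])
qed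

text \<open>Exponential Markov inequality: if all ticks lie at or before k, then exp(k -
  \<open>jump_time n\<close>) is at least 1 for each n. This event thus has probability at most
  exp(k) * (l / (l + 1))^n for every n, hence probability 0. Integer bounds k suffice.\<close>

lemma AE_jump_time_unbounded: "AE \<omega> in \<Omega>. \<forall>c. \<exists>n. c < jump_time n \<omega>"
proof -
  have "AE \<omega> in \<Omega>. \<exists>n. real k < jump_time n \<omega>" for k :: nat
  proof -
    let ?A = "{\<omega> \<in> space \<Omega>. \<forall>n. jump_time n \<omega> \<le> real k}"
    have A: "?A \<in> sets \<Omega>" by measurable
    have "emeasure \<Omega> ?A \<le> ennreal (exp (real k) * (l / (l + 1)) ^ n)" for n
    proof -
      have "emeasure \<Omega> ?A = (\<integral>\<^sup>+\<omega>. indicator ?A \<omega> \<partial>\<Omega>)" using A by simp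
      also have "\<dots> \<le> (\<integral>\<^sup>+\<omega>. ennreal (exp (real k)) * ennreal (exp (- jump_time n \<omega>)) \<partial>\<Omega>)"
      proof (intro nn_integral_mono)
        fix \<omega>
        show "indicator ?A \<omega> \<le> ennreal (exp (real k)) * ennreal (exp (- jump_time n \<omega>))"
          by (auto simp: indicator_def ennreal_mult[symmetric] exp_add[symmetric] simp flip: ennreal_1
              intro!: ennreal_leI)
      qed
      also have "\<dots> = ennreal (exp (real k) * (l / (l + 1)) ^ n)"
        using l_pos by (subst nn_integral_cmult) (auto simp: nn_integral_exp_jump_time ennreal_mult)
      finally show ?thesis .
    qed
    moreover have "(\<lambda>n. ennreal (exp (real k) * (l / (l + 1)) ^ n)) \<longlonglongrightarrow> ennreal (exp (real k) * 0)"
      using l_pos by (intro tendsto_ennrealI tendsto_mult tendsto_const LIMSEQ_realpow_zero) auto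
    ultimately have "emeasure \<Omega> ?A \<le> ennreal (exp (real k) * 0)"
      by (intro LIMSEQ_le_const[of _ _ "emeasure \<Omega> ?A"]) auto
    then have "?A \<in> null_sets \<Omega>" using A by (auto simp: null_sets_def)
    then show ?thesis by (rule AE_I') (auto simp: not_less)
  qed
  then have "AE \<omega> in \<Omega>. \<forall>k::nat. \<exists>n. real k < jump_time n \<omega>" by (simp add: AE_all_countable)
  then show ?thesis
  proof eventually_elim
    case (elim \<omega>)
    show ?case
    proof
      fix c
      obtain k :: nat where "c \<le> real k" using real_arch_simple by blast
      then show "\<exists>n. c < jump_time n \<omega>" using elim by (meson le_less_trans)
    qed
  qed
qed

lemma AE_expo_pos: "AE \<xi> in expo. 0 < \<xi>"
  using AE_lborel_singleton[of 0]
  by (subst AE_density) (auto simp: exponential_density_def elim!: eventually_mono)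

lemma AE_gaps_pos: "AE \<omega> in \<Omega>. \<forall>i. 0 < fst (\<omega> !! i)"
proof -
  have gt: "{z \<in> space \<nu>. 0 < fst z} \<in> sets \<nu>" by measurable
  from AE_expo_pos have *: "AE z in expo \<Otimes>\<^sub>M Q. 0 < fst z"
    using gt[unfolded \<nu>_def] by (intro expo_Q.AE_pair_measure) (auto elim!: eventually_mono)
  have "AE \<omega> in \<Omega>. stream_all (\<lambda>z. 0 < fst z) \<omega>"
    using *[folded \<nu>_def] unfolding \<Omega>_def by (intro \<nu>.AE_stream_all) simp_all
  then show ?thesis by eventually_elim (auto simp: stream.pred_set snth_sset)
qed

text \<open>The recursive count suits inductions over ticks, the partial sums suit estimates and the
  partition of the time interval; this translates between them. Positive gaps make the partial sums
  increase, which the recursion tacitly relies on.\<close>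

lemma cnt_iff_jump_time:
  assumes "\<forall>i. 0 < fst (\<omega> !! i)" "0 \<le> c"
  shows "cnt n c \<omega> \<longleftrightarrow> jump_time n \<omega> \<le> c \<and> c < jump_time (Suc n) \<omega>"
  using assms
proof (induction n arbitrary: c \<omega>)
  case 0
  then show ?case by (simp add: jump_time_Suc)
next
  case (Suc n)
  have pos: "\<forall>i. 0 < fst (stl \<omega> !! i)" using Suc.prems(1) by (metis snth.simps(2))
  then have "0 \<le> jump_time n (stl \<omega>)"
    unfolding jump_time_def by (intro sum_nonneg) (auto intro: less_imp_le)
  then show ?case
    using Suc.IH[OF pos, of "c - fst (shd \<omega>)"]
    by (auto simp: jump_time_Suc[of n] jump_time_Suc[of "Suc n"])
qed

lemma AE_ex_cnt:
  assumes c: "0 \<le> c"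
  shows "AE \<omega> in \<Omega>. \<exists>n. cnt n c \<omega>"
  using AE_jump_time_unbounded AE_gaps_pos
proof eventually_elim
  case (elim \<omega>)
  define n where "n = (LEAST n. c < jump_time n \<omega>)"
  have n: "c < jump_time n \<omega>"
    unfolding n_def by (rule LeastI_ex) (use elim in blast)
  \<comment> \<open>\<open>jump_time 0\<close> is 0 and does not exceed c, so the least index past c
    has a predecessor, which is the number of ticks.\<close>
  then obtain k where k: "n = Suc k" using c by (cases n) auto
  have "\<not> c < jump_time k \<omega>"
    using not_less_Least[of k "\<lambda>n. c < jump_time n \<omega>"] k n_def by simp
  then show ?case using n k elim c by (auto simp: cnt_iff_jump_time not_less intro!: exI[of _ k])
qed

text \<open>If infinitely many ticks accumulate, the least element is junk; this is a null event.\<close>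

definition events :: "real \<Rightarrow> (real \<times> real) stream \<Rightarrow> nat" where
  "events c \<omega> = (LEAST n. cnt n c \<omega>)"

definition process :: "real \<Rightarrow> 's \<Rightarrow> (real \<times> real) stream \<Rightarrow> real \<Rightarrow> 's" where
  "process s x \<omega> t = path (events (t - s) \<omega>) s x \<omega> t"

definition future :: "real \<Rightarrow> (real \<times> real) stream \<Rightarrow> (real \<times> real) stream" where
  "future c \<omega> = resid (events c \<omega>) c \<omega>"

section \<open>The process and its remaining noise: measurability, regeneration, restart\<close>

lemma events_eq: "cnt n c \<omega> \<Longrightarrow> events c \<omega> = n"
  unfolding events_def by (metis LeastI cnt_unique)

lemma process_in_space [simp]: "x \<in> space K \<Longrightarrow> process s x \<omega> t \<in> space K"
  by (simp add: process_def)

lemma measurable_events [measurable (raw)]: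
  assumes [measurable]: "f \<in> N \<rightarrow>\<^sub>M borel" "g \<in> N \<rightarrow>\<^sub>M \<Omega>"
  shows "(\<lambda>w. events (f w) (g w)) \<in> N \<rightarrow>\<^sub>M count_space UNIV"
  unfolding events_def by measurable

lemma measurable_process [measurable (raw)]:
  assumes [measurable]: "f \<in> N \<rightarrow>\<^sub>M borel" "h \<in> N \<rightarrow>\<^sub>M K" "g \<in> N \<rightarrow>\<^sub>M \<Omega>" "k \<in> N \<rightarrow>\<^sub>M borel"
  shows "(\<lambda>w. process (f w) (h w) (g w) (k w)) \<in> N \<rightarrow>\<^sub>M K"
  unfolding process_def
  by (rule measurable_compose_countable[where f="\<lambda>n w. path n (f w) (h w) (g w) (k w)"]) measurable

lemma measurable_future [measurable (raw)]:
  assumes [measurable]: "f \<in> N \<rightarrow>\<^sub>M borel" "g \<in> N \<rightarrow>\<^sub>M \<Omega>"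
  shows "(\<lambda>w. future (f w) (g w)) \<in> N \<rightarrow>\<^sub>M \<Omega>"
  unfolding future_def
  by (rule measurable_compose_countable[where f="\<lambda>n w. resid n (f w) (g w)"]) measurable

lemma nn_integral_cnt:
  assumes [measurable]: "f \<in> borel_measurable \<Omega>" and c: "0 \<le> c"
  shows "(\<integral>\<^sup>+\<omega>. f \<omega> \<partial>\<Omega>) = (\<Sum>n. \<integral>\<^sup>+\<omega>. (if cnt n c \<omega> then f \<omega> else 0) \<partial>\<Omega>)"
proof -
  have "(\<integral>\<^sup>+\<omega>. f \<omega> \<partial>\<Omega>) = (\<integral>\<^sup>+\<omega>. (\<Sum>n. if cnt n c \<omega> then f \<omega> else 0) \<partial>\<Omega>)"
  proof (intro nn_integral_cong_AE)
    show "AE \<omega> in \<Omega>. f \<omega> = (\<Sum>n. if cnt n c \<omega> then f \<omega> else 0)"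
      using AE_ex_cnt[OF c]
    proof eventually_elim
      case (elim \<omega>)
      then obtain k where "cnt k c \<omega>" by blast
      then have "cnt n c \<omega> \<longleftrightarrow> n = k" for n using cnt_unique by blast
      then show ?case
        using sums_unique[OF sums_single[of k "\<lambda>_. f \<omega>"]] by simp
    qed
  qed
  also have "\<dots> = (\<Sum>n. \<integral>\<^sup>+\<omega>. (if cnt n c \<omega> then f \<omega> else 0) \<partial>\<Omega>)"
    by (rule nn_integral_suminf) measurable
  finally show ?thesis .
qed

text \<open>Sums \<open>regeneration_cnt\<close> over the almost surely finite number of ticks. As G
  is a function of both arguments, the joint law of state and remaining noise is thereby a product,
  which is what every later restart uses.\<close>

lemma regeneration:
  assumes [measurable]: "(\<lambda>(y, \<omega>). G y \<omega>) \<in> borel_measurable (K \<Otimes>\<^sub>M \<Omega>)"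
    and x [simp]: "x \<in> space K" and "s \<le> t"
  shows "(\<integral>\<^sup>+\<omega>. G (process s x \<omega> t) (future (t - s) \<omega>) \<partial>\<Omega>) =
    (\<integral>\<^sup>+\<omega>. (\<integral>\<^sup>+\<omega>'. G (process s x \<omega> t) \<omega>' \<partial>\<Omega>) \<partial>\<Omega>)"
proof -
  have c: "0 \<le> t - s" using assms by simp
  have "(\<integral>\<^sup>+\<omega>. (if cnt n (t - s) \<omega> then G (process s x \<omega> t) (future (t - s) \<omega>) else 0) \<partial>\<Omega>) =
    (\<integral>\<^sup>+\<omega>. (if cnt n (t - s) \<omega> then \<integral>\<^sup>+\<omega>'. G (process s x \<omega> t) \<omega>' \<partial>\<Omega> else 0) \<partial>\<Omega>)" for n
    using regeneration_cnt[OF assms, of n] unfolding process_def future_def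
    by (simp add: events_eq cong: if_cong)
  then show ?thesis
    by (subst nn_integral_cnt[OF _ c], simp, subst (2) nn_integral_cnt[OF _ c]) simp_all
qed

text \<open>\<open>cocycle\<close> fails to apply only if ticks accumulate before t or in the
  remaining noise. The first is excluded by \<open>AE_ex_cnt\<close>, the second by
  \<open>regeneration\<close> with the indicator of accumulation for G, which carries the same fact
  over to the remaining noise.\<close>

lemma AE_process_restart:
  assumes x [simp]: "x \<in> space K" and "s \<le> t" "t \<le> u"
  shows "AE \<omega> in \<Omega>. process s x \<omega> u = process t (process s x \<omega> t) (future (t - s) \<omega>) u"
proof -
  have "(\<integral>\<^sup>+\<omega>. of_bool (\<nexists>k. cnt k (u - t) (future (t - s) \<omega>)) \<partial>\<Omega>) =
    (\<integral>\<^sup>+\<omega>. (\<integral>\<^sup>+\<omega>'. of_bool (\<nexists>k. cnt k (u - t) \<omega>') \<partial>\<Omega>) \<partial>\<Omega>)"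
    using assms by (intro regeneration[where G="\<lambda>_ \<omega>. of_bool (\<nexists>k. cnt k (u - t) \<omega>)"]) measurable
  also have "(\<integral>\<^sup>+\<omega>'. of_bool (\<nexists>k. cnt k (u - t) \<omega>') \<partial>\<Omega>) = (\<integral>\<^sup>+\<omega>'. 0 \<partial>\<Omega>)"
    by (rule nn_integral_cong_AE) (use AE_ex_cnt[of "u - t"] assms in \<open>auto elim!: eventually_mono\<close>)
  finally have "(\<integral>\<^sup>+\<omega>. of_bool (\<nexists>k. cnt k (u - t) (future (t - s) \<omega>)) \<partial>\<Omega>) = 0" by simp
  then have "AE \<omega> in \<Omega>. of_bool (\<nexists>k. cnt k (u - t) (future (t - s) \<omega>)) = (0 :: ennreal)"
    by (subst (asm) nn_integral_0_iff_AE) measurable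
  moreover have "AE \<omega> in \<Omega>. \<exists>n. cnt n (t - s) \<omega>" using AE_ex_cnt[of "t - s"] assms by simp
  ultimately show ?thesis
  proof eventually_elim
    case (elim \<omega>)
    then obtain n k where n: "cnt n (t - s) \<omega>" and k: "cnt k (u - t) (future (t - s) \<omega>)"
      by (auto simp: of_bool_def split: if_splits)
    from cocycle[OF assms n k[unfolded future_def events_eq[OF n]]] show ?case
      using k n events_eq[of "n + k" "u - s" \<omega>] by (auto simp: process_def future_def events_eq)
  qed
qed

section \<open>Transition kernels\<close>

definition kernel :: "real \<Rightarrow> real \<Rightarrow> 's \<Rightarrow> 's measure" where
  "kernel s t x = distr \<Omega> K (\<lambda>\<omega>. process s x \<omega> t)"

lemma kernel_measurable [measurable]: "kernel s t \<in> K \<rightarrow>\<^sub>M prob_algebra K"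
  unfolding kernel_def[abs_def]
  by (rule measurable_distr_prob_space2[where M=\<Omega>]) 
     (auto simp: space_prob_algebra \<Omega>.prob_space_axioms)

lemma nn_integral_kernel:
  assumes "x \<in> space K" "f \<in> borel_measurable K"
  shows "(\<integral>\<^sup>+y. f y \<partial>kernel s t x) = (\<integral>\<^sup>+\<omega>. f (process s x \<omega> t) \<partial>\<Omega>)"
  using assms unfolding kernel_def by (intro nn_integral_distr) measurable

lemma emeasure_kernel:
  assumes "x \<in> space K" "B \<in> sets K"
  shows "emeasure (kernel s t x) B = (\<integral>\<^sup>+\<omega>. indicator B (process s x \<omega> t) \<partial>\<Omega>)"
proof -
  have "emeasure (kernel s t x) B = (\<integral>\<^sup>+y. indicator B y \<partial>kernel s t x)"
    using assms by (subst nn_integral_indicator) (simp_all add: kernel_def)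
  then show ?thesis using assms by (simp add: nn_integral_kernel)
qed

lemma nn_integral_restart:
  assumes [measurable]: "(\<lambda>(y, \<omega>). G y \<omega>) \<in> borel_measurable (K \<Otimes>\<^sub>M \<Omega>)" "F \<in> borel_measurable \<Omega>"
    and "x \<in> space K" "s \<le> t"
    and "AE \<omega> in \<Omega>. F \<omega> = G (process s x \<omega> t) (future (t - s) \<omega>)"
  shows "(\<integral>\<^sup>+\<omega>. F \<omega> \<partial>\<Omega>) = (\<integral>\<^sup>+\<omega>. (\<integral>\<^sup>+\<omega>'. G (process s x \<omega> t) \<omega>' \<partial>\<Omega>) \<partial>\<Omega>)"
  using assms(5) by (subst regeneration[symmetric, OF assms(1,3,4)]) (rule nn_integral_cong_AE)

text \<open>The exceptional null set of \<open>AE_process_restart\<close> depends on the starting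
  point but vanishes under the integral, so the equation holds at every x and not just at almost
  every one.\<close>

lemma chapman_kolmogorov:
  assumes x: "x \<in> space K" and "s \<le> t" "t \<le> u"
  shows "kernel s u x = kernel s t x \<bind> kernel t u"
proof (rule measure_eqI)
  have k: "kernel t u \<in> kernel s t x \<rightarrow>\<^sub>M subprob_algebra K"
    using measurable_prob_algebraD[OF kernel_measurable] by (simp add: kernel_def cong: measurable_cong_sets)
  have ne: "space (kernel s t x) \<noteq> {}" using x by (auto simp: kernel_def)
  show "sets (kernel s u x) = sets (kernel s t x \<bind> kernel t u)"
    using sets_bind[of "kernel s t x" "kernel t u" K] ne by (simp add: kernel_def)
  fix B assume "B \<in> sets (kernel s u x)"
  then have [measurable]: "B \<in> sets K" by (simp add: kernel_def)
  have [measurable]: "kernel t u \<in> K \<rightarrow>\<^sub>M subprob_algebra K"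
    by (rule measurable_prob_algebraD[OF kernel_measurable])
  have "emeasure (kernel s u x) B = (\<integral>\<^sup>+\<omega>. indicator B (process s x \<omega> u) \<partial>\<Omega>)"
    by (rule emeasure_kernel) (use x in auto)
  also have "\<dots> = (\<integral>\<^sup>+\<omega>. (\<integral>\<^sup>+\<omega>'. indicator B (process t (process s x \<omega> t) \<omega>' u) \<partial>\<Omega>) \<partial>\<Omega>)"
    by (rule nn_integral_restart[where G="\<lambda>y \<omega>. indicator B (process t y \<omega> u)"])
      (use AE_process_restart[OF assms] assms in \<open>auto elim!: eventually_mono\<close>)
  also have "\<dots> = (\<integral>\<^sup>+\<omega>. emeasure (kernel t u (process s x \<omega> t)) B \<partial>\<Omega>)"
    using x by (intro nn_integral_cong) (simp add: emeasure_kernel)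
  also have "\<dots> = (\<integral>\<^sup>+y. emeasure (kernel t u y) B \<partial>kernel s t x)"
    using x by (intro nn_integral_kernel[symmetric]) auto
  also have "\<dots> = emeasure (kernel s t x \<bind> kernel t u) B"
    by (rule emeasure_bind[symmetric, OF ne k]) auto
  finally show "emeasure (kernel s u x) B = emeasure (kernel s t x \<bind> kernel t u) B" .
qed

section \<open>Finite-dimensional distributions\<close>

abbreviation observe :: "(real \<times> ('s \<Rightarrow> ennreal)) list \<Rightarrow> real \<Rightarrow> 's \<Rightarrow> (real \<times> real) stream \<Rightarrow> ennreal" where
  "observe vs s x \<omega> \<equiv> prod_list (map (\<lambda>(v, g). g (process s x \<omega> v)) vs)"

lemma measurable_observe:
  assumes "\<forall>(v, g)\<in>set vs. g \<in> borel_measurable K" and [measurable]: "h \<in> N \<rightarrow>\<^sub>M K" "k \<in> N \<rightarrow>\<^sub>M \<Omega>"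
  shows "(\<lambda>w. observe vs s (h w) (k w)) \<in> borel_measurable N"
  using assms(1)
proof (induction vs)
  case (Cons p vs)
  obtain v g where p: "p = (v, g)" by fastforce
  have [measurable]: "(\<lambda>w. observe vs s (h w) (k w)) \<in> borel_measurable N" "g \<in> borel_measurable K"
    using Cons p by auto
  show ?case unfolding p by simp
qed simp

lemma AE_observe_restart:
  assumes "x \<in> space K" "s \<le> t" "\<forall>(v, g)\<in>set vs. t \<le> v"
  shows "AE \<omega> in \<Omega>. observe vs s x \<omega> = observe vs t (process s x \<omega> t) (future (t - s) \<omega>)"
  using assms(3)
proof (induction vs)
  case (Cons p vs)
  obtain v g where p: "p = (v, g)" by fastforce
  then have "t \<le> v" "AE \<omega> in \<Omega>. observe vs s x \<omega> = observe vs t (process s x \<omega> t) (future (t - s) \<omega>)"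
    using Cons by auto
  from this(2) AE_process_restart[OF assms(1,2) this(1)] show ?case
    unfolding p by eventually_elim simp
qed simp

text \<open>The Markov property tested on products of functions of the state at finitely many times:
  the observation at u may be replaced by its expectation from the state at t. Restarting at the
  earliest time makes the first factor a constant of the inner integral and leaves a shorter list
  with a new start, hence s and x vary in the induction.\<close>

lemma nn_integral_observe_markov:
  assumes "x \<in> space K" "s \<le> t" "t \<le> u" "f \<in> borel_measurable K"
    and "sorted (map fst vs)" "\<forall>(v, g)\<in>set vs. s \<le> v \<and> v \<le> t \<and> g \<in> borel_measurable K"
  shows "(\<integral>\<^sup>+\<omega>. observe (vs @ [(u, f)]) s x \<omega> \<partial>\<Omega>) =
    (\<integral>\<^sup>+\<omega>. observe (vs @ [(t, \<lambda>y. \<integral>\<^sup>+\<omega>. f (process t y \<omega> u) \<partial>\<Omega>)]) s x \<omega> \<partial>\<Omega>)"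
  using assms
proof (induction vs arbitrary: s x)
  case Nil
  note [measurable] = Nil(4)
  show ?case
    using AE_process_restart[OF Nil(1,2,3)] Nil
    by (simp, intro nn_integral_restart[where G="\<lambda>y \<omega>. f (process t y \<omega> u)"])
      (auto elim!: eventually_mono)
next
  case (Cons p vs)
  obtain v g where p: "p = (v, g)" by fastforce
  have [measurable]: "f \<in> borel_measurable K" "g \<in> borel_measurable K" using Cons.prems p by auto
  have v: "s \<le> v" "v \<le> t" using Cons.prems p by auto
  have step: "(\<integral>\<^sup>+\<omega>. observe (p # ws) s x \<omega> \<partial>\<Omega>) =
      (\<integral>\<^sup>+\<omega>. g (process s x \<omega> v) * (\<integral>\<^sup>+\<omega>'. observe ws v (process s x \<omega> v) \<omega>' \<partial>\<Omega>) \<partial>\<Omega>)"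
    if ws: "\<forall>(w, h)\<in>set ws. v \<le> w \<and> h \<in> borel_measurable K" for ws
  proof -
    have wm: "\<forall>(w, h)\<in>set ws. h \<in> borel_measurable K" using ws by auto
    have AE: "AE \<omega> in \<Omega>. observe ws s x \<omega> = observe ws v (process s x \<omega> v) (future (v - s) \<omega>)"
      by (rule AE_observe_restart[OF Cons.prems(1) v(1)]) (use ws in auto)
    note m [measurable (raw)] = measurable_observe[OF wm]
    have "(\<integral>\<^sup>+\<omega>. observe (p # ws) s x \<omega> \<partial>\<Omega>) =
      (\<integral>\<^sup>+\<omega>. (\<integral>\<^sup>+\<omega>'. g (process s x \<omega> v) * observe ws v (process s x \<omega> v) \<omega>' \<partial>\<Omega>) \<partial>\<Omega>)"
      using AE Cons.prems(1) v(1)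
      by (intro nn_integral_restart[where G="\<lambda>y \<omega>. g y * observe ws v y \<omega>"])
        (auto simp: p elim!: eventually_mono)
    also have "\<dots> = (\<integral>\<^sup>+\<omega>. g (process s x \<omega> v) * (\<integral>\<^sup>+\<omega>'. observe ws v (process s x \<omega> v) \<omega>' \<partial>\<Omega>) \<partial>\<Omega>)"
      using Cons.prems(1) by (intro nn_integral_cong nn_integral_cmult m) auto
    finally show ?thesis .
  qed
  have vs: "\<forall>(w, h)\<in>set vs. v \<le> w \<and> w \<le> t \<and> h \<in> borel_measurable K"
    using Cons.prems p by (fastforce simp: image_iff)
  have IH: "(\<integral>\<^sup>+\<omega>'. observe (vs @ [(u, f)]) v y \<omega>' \<partial>\<Omega>) =
      (\<integral>\<^sup>+\<omega>'. observe (vs @ [(t, \<lambda>y. \<integral>\<^sup>+\<omega>. f (process t y \<omega> u) \<partial>\<Omega>)]) v y \<omega>' \<partial>\<Omega>)"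
    if "y \<in> space K" for y
    using that Cons.prems p v vs by (intro Cons.IH) auto
  have 1: "\<forall>(w, h)\<in>set (vs @ [(u, f)]). v \<le> w \<and> h \<in> borel_measurable K"
    using vs v Cons.prems(3) by auto
  have 2: "\<forall>(w, h)\<in>set (vs @ [(t, \<lambda>y. \<integral>\<^sup>+\<omega>. f (process t y \<omega> u) \<partial>\<Omega>)]). v \<le> w \<and> h \<in> borel_measurable K"
    using vs v by auto
  have "(\<integral>\<^sup>+\<omega>. observe (p # (vs @ [(u, f)])) s x \<omega> \<partial>\<Omega>) =
    (\<integral>\<^sup>+\<omega>. observe (p # (vs @ [(t, \<lambda>y. \<integral>\<^sup>+\<omega>. f (process t y \<omega> u) \<partial>\<Omega>)])) s x \<omega> \<partial>\<Omega>)"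
  proof (rule trans[OF step[OF 1] trans[OF _ step[OF 2, symmetric]]], rule nn_integral_cong)
    fix \<omega>
    have "process s x \<omega> v \<in> space K" by (rule process_in_space[OF Cons.prems(1)])
    from IH[OF this]
    show "g (process s x \<omega> v) * (\<integral>\<^sup>+\<omega>'. observe (vs @ [(u, f)]) v (process s x \<omega> v) \<omega>' \<partial>\<Omega>) =
      g (process s x \<omega> v) * (\<integral>\<^sup>+\<omega>'. observe (vs @ [(t, \<lambda>y. \<integral>\<^sup>+\<omega>. f (process t y \<omega> u) \<partial>\<Omega>)])
        v (process s x \<omega> v) \<omega>' \<partial>\<Omega>)"
      by (rule arg_cong)
  qed
  then show ?case unfolding append_Cons .
qed

section \<open>Motion between ticks and at the start\<close>

lemma path_flow:
  assumes "x \<in> space K" "s \<le> t" "t \<le> u" "cnt n (t - s) \<omega>"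
  shows "path n s x \<omega> u = \<Phi> t u (path n s x \<omega> t)"
  using assms
proof (induction n arbitrary: s x \<omega>)
  case (Suc n)
  then show ?case unfolding path.simps by (intro Suc.IH) (simp_all add: diff_diff_eq)
qed (simp add: flow_flow)

lemma process_between_jumps:
  assumes "x \<in> space K" "\<forall>i. 0 < fst (\<omega> !! i)" "0 \<le> a" "a \<le> b"
    "jump_time n \<omega> \<le> a" "b < jump_time (Suc n) \<omega>"
  shows "process 0 x \<omega> b = \<Phi> a b (process 0 x \<omega> a)"
proof -
  have "cnt n (a - 0) \<omega>" "cnt n (b - 0) \<omega>" using assms by (auto simp: cnt_iff_jump_time)
  then show ?thesis
    using path_flow[of x 0 a b n \<omega>] assms by (simp add: process_def events_eq)
qed

lemma AE_process_start:
  assumes "x \<in> space K"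
  shows "AE \<omega> in \<Omega>. process s x \<omega> s = x"
  using AE_gaps_pos
proof eventually_elim
  case (elim \<omega>)
  \<comment> \<open>A gap of length zero would fire at time s itself and move the state; positive
    gaps rule this out.\<close>
  then have "events 0 \<omega> = 0" using elim[rule_format, of 0] by (intro events_eq) simp
  then show ?case using assms by (simp add: process_def flow_refl)
qed

section \<open>Short-time behaviour of the kernels\<close>

lemma measure_expo:
  assumes "0 \<le> c" shows "measure expo {c<..} = exp (- l * c)" "measure expo {..c} = 1 - exp (- l * c)"
proof -
  have "emeasure expo {c<..} = (\<integral>\<^sup>+\<xi>. indicator {c<..} \<xi> \<partial>expo)"
    by (rule nn_integral_indicator[symmetric]) simp
  also have "\<dots> = (\<integral>\<^sup>+\<xi>. (if c < \<xi> then 1 else 0) \<partial>expo)"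
    by (intro nn_integral_cong) (simp add: indicator_def)
  also have "\<dots> = ennreal (exp (- l * c))"
    using nn_integral_exponential_memoryless[OF _ l_pos assms, of "\<lambda>_. 1"] expo.emeasure_space_1 by simp
  finally show *: "measure expo {c<..} = exp (- l * c)" by (simp add: measure_def)
  have "measure expo (space expo - {c<..}) = 1 - measure expo {c<..}"
    by (rule expo.prob_compl) simp
  also have "space expo - {c<..} = {..c}" by auto
  finally show "measure expo {..c} = 1 - exp (- l * c)" using * by simp
qed

lemma integral_\<nu>:
  fixes f :: "real \<times> real \<Rightarrow> real"
  assumes [measurable]: "f \<in> borel_measurable (borel \<Otimes>\<^sub>M borel)" and "\<And>z. \<bar>f z\<bar> \<le> B"
  shows "(\<integral>z. f z \<partial>\<nu>) = (\<integral>\<xi>. (\<integral>m. f (\<xi>, m) \<partial>Q) \<partial>expo)"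
proof -
  have "f \<in> borel_measurable \<nu>" by measurable
  then have "integrable \<nu> f"
    using assms(2) by (intro \<nu>.integrable_const_bound[where B=B]) auto
  then show ?thesis unfolding \<nu>_def by (rule expo_Q.integral_fst'[symmetric])
qed

lemma measure_\<Omega>_shd:
  assumes [measurable]: "B \<in> sets (borel \<Otimes>\<^sub>M borel)"
  shows "measure \<Omega> {\<omega> \<in> space \<Omega>. shd \<omega> \<in> B} = measure \<nu> B"
    and "measure \<Omega> {\<omega> \<in> space \<Omega>. shd \<omega> \<in> B \<and> shd (stl \<omega>) \<in> B} = (measure \<nu> B)\<^sup>2"
proof -
  have step: "emeasure \<Omega> {\<omega> \<in> space \<Omega>. shd \<omega> \<in> B \<and> stl \<omega> \<in> D} = emeasure \<nu> B * emeasure \<Omega> D"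
    if [measurable]: "D \<in> sets \<Omega>" for D
  proof -
    have S: "{\<omega> \<in> space \<Omega>. shd \<omega> \<in> B \<and> stl \<omega> \<in> D} \<in> sets \<Omega>" by measurable
    have "emeasure \<Omega> {\<omega> \<in> space \<Omega>. shd \<omega> \<in> B \<and> stl \<omega> \<in> D} =
        (\<integral>\<^sup>+\<omega>. indicator B (shd \<omega>) * indicator D (stl \<omega>) \<partial>\<Omega>)"
      unfolding nn_integral_indicator[OF S, symmetric]
      by (intro nn_integral_cong) (auto simp: indicator_def)
    also have "\<dots> = (\<integral>\<^sup>+z. indicator B z * (\<integral>\<^sup>+\<omega>. indicator D \<omega> \<partial>\<Omega>) \<partial>\<nu>)"
      by (subst nn_integral_\<Omega>, simp, intro nn_integral_cong, subst nn_integral_cmult[symmetric]) auto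
    also have "\<dots> = emeasure \<nu> B * emeasure \<Omega> D"
      by (subst nn_integral_multc) auto
    finally show ?thesis .
  qed
  show 1: "measure \<Omega> {\<omega> \<in> space \<Omega>. shd \<omega> \<in> B} = measure \<nu> B"
    using step[OF sets.top] by (simp add: measure_def space_\<Omega> \<Omega>.emeasure_space_1[unfolded space_\<Omega>])
  have "{\<omega> \<in> space \<Omega>. shd \<omega> \<in> B} \<in> sets \<Omega>" by measurable
  then show "measure \<Omega> {\<omega> \<in> space \<Omega>. shd \<omega> \<in> B \<and> shd (stl \<omega>) \<in> B} = (measure \<nu> B)\<^sup>2"
    using step[of "{\<omega> \<in> space \<Omega>. shd \<omega> \<in> B}"] 1
    by (simp add: measure_def space_\<Omega> enn2real_mult power2_eq_square)
qed

text \<open>The process is compared with a surrogate that performs at most the first tick. The two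
  can disagree about A only if a second tick follows in time, whence the square; A is invariant
  under the flow, so only jumps enter or leave it. For the surrogate, no tick leaves the indicator
  of x, and a tick at t + h lands in A with probability q up to \<epsilon>.\<close>

lemma kernel_first_jump_bound:
  assumes A [measurable]: "A \<in> sets K" and x [simp]: "x \<in> space K" and "0 < \<Delta>"
    and inv: "\<And>s u y. y \<in> space K \<Longrightarrow> \<Phi> s u y \<in> A \<longleftrightarrow> y \<in> A"
    and near: "\<And>h. 0 < h \<Longrightarrow> h \<le> \<Delta> \<Longrightarrow> \<bar>measure Q {m. J (t + h) (\<Phi> t (t + h) x) m \<in> A} - q\<bar> \<le> \<epsilon>"
  shows "\<bar>measure (kernel t (t + \<Delta>) x) A - (indicator A x * exp (- l * \<Delta>) + q * (1 - exp (- l * \<Delta>)))\<bar>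
    \<le> (1 - exp (- l * \<Delta>))\<^sup>2 + \<epsilon> * (1 - exp (- l * \<Delta>))"
proof -
  define y where "y z = J (t + fst z) (\<Phi> t (t + fst z) x) (snd z)" for z :: "real \<times> real"
  have [measurable]: "y \<in> borel \<Otimes>\<^sub>M borel \<rightarrow>\<^sub>M K" unfolding y_def[abs_def] by measurable
  have y [simp]: "y z \<in> space K" for z by (simp add: y_def)
  \<comment> \<open>1 exactly if the surrogate whose first gap and mark form z ends in A.\<close>
  define f where "f z = (if \<Delta> < fst z then indicator A x else indicator A (y z) :: real)" for z
  have [measurable]: "f \<in> borel_measurable (borel \<Otimes>\<^sub>M borel)" unfolding f_def[abs_def] by measurable
  have f01: "f z \<in> {0, 1}" for z by (simp add: f_def indicator_def)
  define B where "B = ({..\<Delta>} \<times> UNIV :: (real \<times> real) set)"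
  have [measurable]: "B \<in> sets (borel \<Otimes>\<^sub>M borel)"
    unfolding B_def by measurable
  define F where "F = {z \<in> space (borel \<Otimes>\<^sub>M borel). f z = 1}"
  have [measurable]: "F \<in> sets (borel \<Otimes>\<^sub>M borel)"
    unfolding F_def by measurable
  have F: "z \<in> F \<longleftrightarrow> f z = 1" for z by (simp add: F_def space_pair_measure)
  let ?p = "1 - exp (- l * \<Delta>)"
  have "emeasure \<nu> B = emeasure expo {..\<Delta>} * emeasure Q UNIV"
    unfolding \<nu>_def B_def by (rule Q.emeasure_pair_measure_Times) (simp_all add: sets_Q)
  then have B: "measure \<nu> B = ?p"
    using Q.emeasure_space_1 measure_expo(2)[of \<Delta>] assms(3) by (simp add: space_Q measure_def)

  define E where "E = {\<omega> \<in> space \<Omega>. process t x \<omega> (t + \<Delta>) \<in> A}"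
  define F' where "F' = {\<omega> \<in> space \<Omega>. shd \<omega> \<in> F}"
  \<comment> \<open>Two ticks within \<Delta> force both gaps to be at most \<Delta>. This larger
    event restricts the two gaps separately, so its probability is a square.\<close>
  define C where "C = {\<omega> \<in> space \<Omega>. shd \<omega> \<in> B \<and> shd (stl \<omega>) \<in> B}"
  have [measurable]: "E \<in> sets \<Omega>" "F' \<in> sets \<Omega>" "C \<in> sets \<Omega>"
    unfolding E_def F'_def C_def by measurable
  have EF: "AE \<omega> in \<Omega>. \<omega> \<notin> C \<longrightarrow> (\<omega> \<in> E \<longleftrightarrow> \<omega> \<in> F')"
    using AE_gaps_pos
  proof eventually_elim
    case (elim \<omega>)
    obtain \<xi> m \<xi>' m' \<omega>' where \<omega>: "\<omega> = (\<xi>, m) ## (\<xi>', m') ## \<omega>'" by (metis stream.exhaust surj_pair)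
    have "0 < \<xi>" using elim[rule_format, of 0] \<omega> by simp
    show ?case
    proof (cases "\<Delta> < \<xi>")
      case True
      then have "events \<Delta> \<omega> = 0" by (intro events_eq) (simp add: \<omega>)
      then show ?thesis
        using True by (simp add: E_def F'_def F space_\<Omega> process_def f_def \<omega> inv indicator_def)
    next
      case False
      show ?thesis
      proof (cases "\<Delta> < \<xi>'")
        case True
        then have "events \<Delta> \<omega> = Suc 0" using False \<open>0 < \<xi>\<close> by (intro events_eq) (simp add: \<omega>)
        then show ?thesis
          using False by (simp add: E_def F'_def F space_\<Omega> process_def f_def \<omega> inv y_def indicator_def)
      qed (use False in \<open>simp add: \<omega> C_def B_def space_\<Omega>\<close>)
    qed
  qed
  have "measure \<Omega> E \<le> measure \<Omega> (F' \<union> C)"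
    using EF by (intro \<Omega>.finite_measure_mono_AE) (auto elim!: eventually_mono)
  moreover have "measure \<Omega> F' \<le> measure \<Omega> (E \<union> C)"
    using EF by (intro \<Omega>.finite_measure_mono_AE) (auto elim!: eventually_mono)
  moreover have "measure \<Omega> (F' \<union> C) \<le> measure \<Omega> F' + measure \<Omega> C" "measure \<Omega> (E \<union> C) \<le> measure \<Omega> E + measure \<Omega> C"
    by (intro measure_Un_le; simp)+
  moreover have "measure \<Omega> C = ?p\<^sup>2" "measure \<Omega> F' = measure \<nu> F"
    using measure_\<Omega>_shd[of B] measure_\<Omega>_shd(1)[of F] by (simp_all add: C_def F'_def space_\<Omega> B)
  ultimately have 1: "\<bar>measure \<Omega> E - measure \<nu> F\<bar> \<le> ?p\<^sup>2" by linarith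

  \<comment> \<open>\<open>g\<close> is the probability that the surrogate ends in A given the first
    gap; \<open>g0\<close> puts q for gaps up to \<Delta>, at a cost of \<epsilon> there, and agrees
    with \<open>g\<close> beyond.\<close>
  define g where "g \<xi> = (\<integral>m. f (\<xi>, m) \<partial>Q)" for \<xi>
  define g0 where "g0 \<xi> = indicator A x * indicator {\<Delta><..} \<xi> + q * indicator {..\<Delta>} \<xi>" for \<xi> :: real
  have [measurable]: "g \<in> borel_measurable borel" unfolding g_def[abs_def] by measurable
  have f_bound: "0 \<le> f z" "f z \<le> 1" for z by (simp_all add: f_def indicator_def)
  have "integrable Q (\<lambda>m. f (\<xi>, m))" for \<xi>
    using f_bound by (intro Q.integrable_const_bound[where B=1]) auto
  then have "0 \<le> g \<xi>" "g \<xi> \<le> 1" for \<xi>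
    unfolding g_def using f_bound by (auto intro!: integral_nonneg Q.integral_le_const)
  then have gi: "integrable expo g" by (intro expo.integrable_const_bound[where B=1]) auto
  have g0i: "integrable expo g0" unfolding g0_def[abs_def] by (intro expo.integrable_const_bound[where B="1 + \<bar>q\<bar>"]) (auto simp: indicator_def)
  have "measure \<nu> F = (\<integral>z. indicator F z \<partial>\<nu>)" by simp
  also have "\<dots> = (\<integral>z. f z \<partial>\<nu>)"
    using f01 by (intro Bochner_Integration.integral_cong) (auto simp: indicator_def F)
  also have "\<dots> = (\<integral>\<xi>. g \<xi> \<partial>expo)"
    unfolding g_def using f_bound by (intro integral_\<nu>[where B=1]) auto
  finally have 2: "measure \<nu> F = (\<integral>\<xi>. g \<xi> \<partial>expo)" .
  have ind: "integrable expo (indicator S :: real \<Rightarrow> real)" if "S \<in> sets borel" for S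
    using that by (intro expo.integrable_const_bound[where B=1]) auto
  have 3: "(\<integral>\<xi>. g0 \<xi> \<partial>expo) = indicator A x * exp (- l * \<Delta>) + q * ?p"
    unfolding g0_def using measure_expo[of \<Delta>] assms(3) ind by (subst Bochner_Integration.integral_add) auto
  have near0: "AE \<xi> in expo. \<bar>g \<xi> - g0 \<xi>\<bar> \<le> \<epsilon> * indicator {..\<Delta>} \<xi>"
    using AE_expo_pos
  proof eventually_elim
    case (elim \<xi>)
    show ?case
    proof (cases "\<Delta> < \<xi>")
      case True
      then show ?thesis by (simp add: g_def g0_def f_def Q.prob_space)
    next
      case False
      have "g \<xi> = (\<integral>m. indicator {m. y (\<xi>, m) \<in> A} m \<partial>Q)"
        using False by (simp add: g_def f_def indicator_def)
      also have "\<dots> = measure Q {m. J (t + \<xi>) (\<Phi> t (t + \<xi>) x) m \<in> A}"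
        by (simp add: y_def space_Q)
      finally show ?thesis using near[of \<xi>] False elim by (simp add: g0_def)
    qed
  qed
  have "\<bar>(\<integral>\<xi>. g \<xi> \<partial>expo) - (\<integral>\<xi>. g0 \<xi> \<partial>expo)\<bar> = \<bar>\<integral>\<xi>. g \<xi> - g0 \<xi> \<partial>expo\<bar>"
    using gi g0i by simp
  also have "\<dots> \<le> (\<integral>\<xi>. \<bar>g \<xi> - g0 \<xi>\<bar> \<partial>expo)" by (rule integral_abs_bound)
  also have "\<dots> \<le> (\<integral>\<xi>. \<epsilon> * indicator {..\<Delta>} \<xi> \<partial>expo)"
    using gi g0i near0 ind by (intro integral_mono_AE) auto
  also have "\<dots> = \<epsilon> * ?p" using measure_expo[of \<Delta>] assms(3) by simp
  finally have 4: "\<bar>(\<integral>\<xi>. g \<xi> \<partial>expo) - (\<integral>\<xi>. g0 \<xi> \<partial>expo)\<bar> \<le> \<epsilon> * ?p" .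
  have 5: "measure (kernel t (t + \<Delta>) x) A = measure \<Omega> E"
    unfolding kernel_def E_def by (subst measure_distr) (auto intro!: arg_cong[where f="measure \<Omega>"])
  show ?thesis using 1 2 3 4 5 by linarith
qed

text \<open>To first order a tick occurs with probability l * \<Delta> and replaces the indicator of
  x by q. The limit q is taken along the flow because the state drifts until the tick.\<close>

lemma kernel_derivative:
  assumes A: "A \<in> sets K" and x: "x \<in> space K"
    and inv: "\<And>s u y. y \<in> space K \<Longrightarrow> \<Phi> s u y \<in> A \<longleftrightarrow> y \<in> A"
    and lim: "((\<lambda>h. measure Q {m. J (t + h) (\<Phi> t (t + h) x) m \<in> A}) \<longlongrightarrow> q) (at_right 0)"
  shows "(\<lambda>\<Delta>. measure (kernel t (t + \<Delta>) x) A - (indicator A x + \<Delta> * l * (q - indicator A x)))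
    \<in> o[at_right 0](\<lambda>\<Delta>. \<Delta>)"
proof (rule landau_o.smallI)
  fix c :: real assume c: "0 < c"
  define a where "a = \<bar>q - indicator A x\<bar>"
  have "\<forall>\<^sub>F h in at_right 0. \<bar>measure Q {m. J (t + h) (\<Phi> t (t + h) x) m \<in> A} - q\<bar> < c / (2 * l)"
    using lim c l_pos unfolding tendsto_iff dist_real_def by simp
  then obtain d where d: "0 < d" and near: "\<And>h. 0 < h \<Longrightarrow> h < d \<Longrightarrow>
      \<bar>measure Q {m. J (t + h) (\<Phi> t (t + h) x) m \<in> A} - q\<bar> < c / (2 * l)"
    by (auto simp: eventually_at_right_field)
  \<comment> \<open>The allowance c * \<Delta> is halved: one half pays for the deviation from q,
    namely c / (2 * l) times y = l * \<Delta>, the other for the quadratic errors (1 + a) * y^2,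
    which requires this bound on \<Delta>.\<close>
  have "0 < c / (2 * (1 + a) * l\<^sup>2)"
    using c l_pos by (intro divide_pos_pos mult_pos_pos) (auto simp: a_def)
  then have small: "\<forall>\<^sub>F \<Delta> in at_right 0. 0 < \<Delta> \<and> \<Delta> < min d (c / (2 * (1 + a) * l\<^sup>2))"
    using d by (auto simp: eventually_at_right_field intro!: exI[of _ "min d (c / (2 * (1 + a) * l\<^sup>2))"])
  show "\<forall>\<^sub>F \<Delta> in at_right 0. norm (measure (kernel t (t + \<Delta>) x) A - (indicator A x + \<Delta> * l * (q - indicator A x)))
      \<le> c * norm \<Delta>"
    using small
  proof eventually_elim
    case (elim \<Delta>)
    define y where "y = l * \<Delta>"
    define p where "p = 1 - exp (- y)"
    have y: "0 \<le> y" using elim l_pos by (simp add: y_def)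
    have "p \<le> y" using exp_ge_add_one_self[of "- y"] by (simp add: p_def)
    have "0 \<le> p" using y by (simp add: p_def)
    \<comment> \<open>The product (1 + y) * (1 - y + y^2) is 1 + y^3, hence at least 1; cancelling 1
      + y bounds exp(- y) by 1 - y + y^2.\<close>
    have "(1 + y) * exp (- y) \<le> exp y * exp (- y)"
      by (intro mult_right_mono exp_ge_add_one_self) auto
    then have "(1 + y) * exp (- y) \<le> 1" by (simp add: exp_add[symmetric])
    also have "1 \<le> (1 + y) * (1 - y + y\<^sup>2)" using y by (simp add: algebra_simps power2_eq_square)
    finally have "exp (- y) \<le> 1 - y + y\<^sup>2" using y by simp
    then have py: "\<bar>p - y\<bar> \<le> y\<^sup>2" using \<open>p \<le> y\<close> by (simp add: p_def)
    have K: "\<bar>measure (kernel t (t + \<Delta>) x) A - (indicator A x * exp (- l * \<Delta>) + q * (1 - exp (- l * \<Delta>)))\<bar>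
      \<le> p\<^sup>2 + c / (2 * l) * p"
      unfolding p_def y_def using elim near
      by (intro order_trans[OF kernel_first_jump_bound[OF A x _ inv, where \<epsilon>="c / (2 * l)"]])
        (auto intro!: less_imp_le)
    have "indicator A x * exp (- l * \<Delta>) + q * (1 - exp (- l * \<Delta>)) - (indicator A x + \<Delta> * l * (q - indicator A x))
      = (q - indicator A x) * (p - y)"
      by (simp add: p_def y_def algebra_simps)
    moreover have "\<bar>(q - indicator A x) * (p - y)\<bar> \<le> a * y\<^sup>2"
      unfolding abs_mult a_def using py by (intro mult_left_mono) auto
    moreover have "p\<^sup>2 \<le> y\<^sup>2" using \<open>0 \<le> p\<close> \<open>p \<le> y\<close> by (rule power_mono[rotated])
    moreover have "c / (2 * l) * p \<le> c / (2 * l) * y" using \<open>p \<le> y\<close> c l_pos by (intro mult_left_mono) auto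
    ultimately have "\<bar>measure (kernel t (t + \<Delta>) x) A - (indicator A x + \<Delta> * l * (q - indicator A x))\<bar>
      \<le> (1 + a) * y\<^sup>2 + c / (2 * l) * y"
      using K by (simp add: algebra_simps)
    also have "(1 + a) * y\<^sup>2 = (2 * (1 + a) * l\<^sup>2 * \<Delta>) * \<Delta> / 2"
      by (simp add: y_def power2_eq_square)
    also have "\<dots> \<le> c * \<Delta> / 2"
    proof -
      have "2 * (1 + a) * l\<^sup>2 * \<Delta> \<le> c"
        using elim l_pos by (simp add: a_def pos_less_divide_eq add_pos_nonneg mult_ac)
      then show ?thesis using elim by (intro divide_right_mono mult_right_mono) auto
    qed
    also have "c / (2 * l) * y = c * \<Delta> / 2" using l_pos by (simp add: y_def)
    finally show ?case using elim by (simp add: mult.commute)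
  qed
qed

end

section \<open>The Markov property\<close>

text \<open>The theorem prescribes real sequences as sample points, whereas the noise consists of
  streams of pairs. D reads the noise off an arbitrary probability space, and only its law is
  used.\<close>

locale driven_jump_flow = jump_flow K Q l \<Phi> J
  for K :: "'s measure" and Q l \<Phi> J +
  fixes M :: "'w measure" and D :: "'w \<Rightarrow> (real \<times> real) stream" and x0 :: 's
  assumes prob_M: "prob_space M" and D_measurable [measurable]: "D \<in> M \<rightarrow>\<^sub>M \<Omega>"
    and D_law: "distr M \<Omega> D = \<Omega>" and x0: "x0 \<in> space K"
begin

sublocale M: prob_space M by (rule prob_M)

definition X :: "real \<Rightarrow> 'w \<Rightarrow> 's" where
  "X t w = process 0 x0 (D w) t"

lemma X_measurable [measurable]: "X t \<in> M \<rightarrow>\<^sub>M K"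
  unfolding X_def[abs_def] using x0 by measurable

lemma X_in_space [simp]: "X t w \<in> space K"
  by (simp add: X_def x0)

lemma nn_integral_D: "f \<in> borel_measurable \<Omega> \<Longrightarrow> (\<integral>\<^sup>+w. f (D w) \<partial>M) = (\<integral>\<^sup>+\<omega>. f \<omega> \<partial>\<Omega>)"
  by (subst D_law[symmetric]) (rule nn_integral_distr[symmetric], simp_all)

lemma AE_D: "AE \<omega> in \<Omega>. R \<omega> \<Longrightarrow> AE w in M. R (D w)"
  by (rule AE_distrD[OF D_measurable]) (subst D_law)

lemma sets_natural_filtration:
  "sets (natural_filtration M K X s) =
    sigma_sets (space M) (\<Union>u\<in>{0..s}. {X u -` B \<inter> space M | B. B \<in> sets K})"
  unfolding natural_filtration_def by (rule sets_measure_of) auto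

lemma space_natural_filtration: "space (natural_filtration M K X s) = space M"
  unfolding natural_filtration_def by (rule space_measure_of) auto

text \<open>Turns an event of the past into the preimage of a measurable set of restricted paths. On
  that product space the finite-dimensional cylinders determine a finite measure.\<close>

lemma natural_filtration_subset:
  "sets (natural_filtration M K X s) \<subseteq> sets (vimage_algebra (space M) (\<lambda>w. \<lambda>u\<in>{0..s}. X u w) (\<Pi>\<^sub>M u\<in>{0..s}. K))"
    (is "_ \<subseteq> sets ?V")
proof -
  have "sigma_sets (space M) (\<Union>u\<in>{0..s}. {X u -` B \<inter> space M | B. B \<in> sets K}) \<subseteq> sets ?V"
  proof (rule sets.sigma_sets_subset[of _ ?V, simplified], safe)
    fix u B assume u: "u \<in> {0..s}" and B: "B \<in> sets K"
    have "(\<lambda>w. \<lambda>u\<in>{0..s}. X u w) \<in> ?V \<rightarrow>\<^sub>M (\<Pi>\<^sub>M u\<in>{0..s}. K)"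
      by (rule measurable_vimage_algebra1) (auto simp: space_PiM)
    from measurable_compose[OF this measurable_component_singleton[OF u]]
    have "X u \<in> ?V \<rightarrow>\<^sub>M K" using u by simp
    from measurable_sets[OF this B] show "X u -` B \<inter> space M \<in> sets ?V" by simp
  qed
  then show ?thesis unfolding sets_natural_filtration .
qed

text \<open>Both sides are finite measures evaluated at A. Transported by the restricted path they
  agree on cylinders, by \<open>nn_integral_observe_markov\<close>, hence on the whole product
  space, and every event of the past comes from there.\<close>

lemma nn_integral_X_markov:
  assumes "0 \<le> s" "s \<le> t" and B [measurable]: "B \<in> sets K" and A: "A \<in> sets (natural_filtration M K X s)"
  shows "(\<integral>\<^sup>+w. indicator B (X t w) * indicator A w \<partial>M) =
    (\<integral>\<^sup>+w. emeasure (kernel s t (X s w)) B * indicator A w \<partial>M)"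
proof -
  let ?I = "{0..s}" and ?P = "\<Pi>\<^sub>M u\<in>{0..s}. K"
  define path where "path w = (\<lambda>u\<in>?I. X u w)" for w
  have [measurable]: "path \<in> M \<rightarrow>\<^sub>M ?P"
    unfolding path_def[abs_def] by (rule measurable_restrict) simp
  have [measurable]: "kernel s t \<in> K \<rightarrow>\<^sub>M subprob_algebra K"
    by (rule measurable_prob_algebraD[OF kernel_measurable])
  define f1 where "f1 w = (indicator B (X t w) :: ennreal)" for w
  define f2 where "f2 w = emeasure (kernel s t (X s w)) B" for w
  have [measurable]: "f1 \<in> borel_measurable M" unfolding f1_def[abs_def] by measurable
  have [measurable]: "f2 \<in> borel_measurable M" unfolding f2_def[abs_def] by measurable
  have "distr (density M f1) ?P path = distr (density M f2) ?P path"
  proof (rule measure_eqI_PiM_infinite)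
    fix A J assume J: "finite J" "J \<subseteq> ?I" and A: "\<And>i. i \<in> J \<Longrightarrow> A i \<in> sets K"
    have E [measurable]: "prod_emb ?I (\<lambda>_. K) J (Pi\<^sub>E J A) \<in> sets ?P"
      using J A by (intro sets_PiM_I) auto
    \<comment> \<open>The indicator of the cylinder as a product of observations; the times are
      sorted because the Markov identity peels off the earliest one first.\<close>
    define vs where "vs = map (\<lambda>v. (v, indicator (A v) :: 's \<Rightarrow> ennreal)) (sorted_list_of_set J)"
    have obs: "observe vs 0 x0 (D w) = indicator (prod_emb ?I (\<lambda>_. K) J (Pi\<^sub>E J A)) (path w)" for w
    proof -
      have "observe vs 0 x0 (D w) = (\<Prod>v\<in>J. indicator (A v) (X v w))"
        unfolding vs_def using J(1)
        by (simp add: comp_def X_def prod.distinct_set_conv_list[symmetric])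
      also have "\<dots> = (if \<forall>v\<in>J. X v w \<in> A v then 1 else 0)"
        using J(1) by (auto simp: indicator_def intro!: prod.neutral)
      also have "\<dots> = indicator (prod_emb ?I (\<lambda>_. K) J (Pi\<^sub>E J A)) (path w)"
        using J(2) by (auto simp: prod_emb_def path_def space_PiM indicator_def PiE_iff subset_eq)
      finally show ?thesis .
    qed
    have vs: "sorted (map fst vs)" "\<forall>(v, g)\<in>set vs. 0 \<le> v \<and> v \<le> s \<and> g \<in> borel_measurable K"
      using J A by (auto simp: vs_def comp_def subset_eq)
    have k: "(\<lambda>y. \<integral>\<^sup>+\<omega>. indicator B (process s y \<omega> t) \<partial>\<Omega>) \<in> borel_measurable K" by measurable
    have vs': "\<forall>(v, g)\<in>set vs. g \<in> borel_measurable K" using vs by auto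
    have [measurable]: "observe (vs @ [(t, indicator B)]) 0 x0 \<in> borel_measurable \<Omega>"
      "observe (vs @ [(s, \<lambda>y. \<integral>\<^sup>+\<omega>. indicator B (process s y \<omega> t) \<partial>\<Omega>)]) 0 x0 \<in> borel_measurable \<Omega>"
      by (rule measurable_observe; use vs' k x0 in auto)+
    have "(\<integral>\<^sup>+w. f1 w * indicator (prod_emb ?I (\<lambda>_. K) J (Pi\<^sub>E J A)) (path w) \<partial>M) =
        (\<integral>\<^sup>+w. observe (vs @ [(t, indicator B)]) 0 x0 (D w) \<partial>M)"
      by (intro nn_integral_cong) (simp add: obs[symmetric] f1_def X_def mult.commute)
    also have "\<dots> = (\<integral>\<^sup>+\<omega>. observe (vs @ [(t, indicator B)]) 0 x0 \<omega> \<partial>\<Omega>)"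
      by (rule nn_integral_D) measurable
    also have "\<dots> = (\<integral>\<^sup>+\<omega>. observe (vs @ [(s, \<lambda>y. \<integral>\<^sup>+\<omega>. indicator B (process s y \<omega> t) \<partial>\<Omega>)]) 0 x0 \<omega> \<partial>\<Omega>)"
      by (rule nn_integral_observe_markov) (use assms x0 vs in auto)
    also have "\<dots> = (\<integral>\<^sup>+w. observe (vs @ [(s, \<lambda>y. \<integral>\<^sup>+\<omega>. indicator B (process s y \<omega> t) \<partial>\<Omega>)]) 0 x0 (D w) \<partial>M)"
      by (rule nn_integral_D[symmetric]) measurable
    also have "\<dots> = (\<integral>\<^sup>+w. f2 w * indicator (prod_emb ?I (\<lambda>_. K) J (Pi\<^sub>E J A)) (path w) \<partial>M)"
      by (intro nn_integral_cong)
        (simp add: obs[symmetric] f2_def emeasure_kernel x0 X_def[symmetric] mult.commute)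
    finally show "emeasure (distr (density M f1) ?P path) (prod_emb ?I (\<lambda>_. K) J (Pi\<^sub>E J A)) =
        emeasure (distr (density M f2) ?P path) (prod_emb ?I (\<lambda>_. K) J (Pi\<^sub>E J A))"
      by (simp add: nn_integral_indicator[symmetric, OF measurable_sets] emeasure_distr emeasure_density
          indicator_def vimage_def cong: nn_integral_cong)
  next
    have "emeasure (density M f1) (space M) \<le> emeasure M (space M)"
      by (subst emeasure_density) (auto simp: f1_def nn_integral_indicator[symmetric] intro!: nn_integral_mono split: split_indicator simp del: nn_integral_indicator)
    then show "finite_measure (distr (density M f1) ?P path)"
      using M.emeasure_space_1
      by (intro finite_measure.finite_measure_distr finite_measureI) (auto simp: top_unique)
  qed simp_all
  moreover obtain A' where A': "A' \<in> sets ?P" "A = path -` A' \<inter> space M"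
    using subsetD[OF natural_filtration_subset A] unfolding path_def[abs_def, symmetric]
    by (subst (asm) sets_vimage_algebra2) (auto simp: path_def space_PiM)
  ultimately have "emeasure (distr (density M f1) ?P path) A' = emeasure (distr (density M f2) ?P path) A'"
    by simp
  then show ?thesis
    using A' by (simp add: emeasure_distr emeasure_density f1_def f2_def)
qed

text \<open>F may be any algebra between the one generated by \<open>X s\<close> and the natural
  filtration. Used at both extremes, this identifies the two conditional probabilities in
  \<open>markov_process\<close> with the same kernel value.\<close>

lemma cond_prob_X:
  assumes st: "0 \<le> s" "s \<le> t" and B [measurable]: "B \<in> sets K"
    and F: "space F = space M" "sets F \<subseteq> sets (natural_filtration M K X s)" "X s \<in> F \<rightarrow>\<^sub>M K"
  shows "AE w in M. cond_prob_wrt M F (X t -` B \<inter> space M) w = measure (kernel s t (X s w)) B"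
proof -
  have "sets (natural_filtration M K X s) \<subseteq> sets M"
    unfolding sets_natural_filtration
    by (rule sets.sigma_sets_subset) (auto intro: measurable_sets[OF X_measurable])
  then have sub: "subalgebra M F" using F by (auto simp: subalgebra_def)
  interpret finite_measure_subalgebra M F by standard (rule sub)
  have [measurable]: "(\<lambda>y. measure (kernel s t y) B) \<in> borel_measurable K"
    using measurable_prob_algebraD[OF kernel_measurable] by measurable
  have [measurable]: "(\<lambda>w. measure (kernel s t (X s w)) B) \<in> borel_measurable F"
    using F(3) by measurable
  interpret k: prob_space "kernel s t (X s w)" for w
    unfolding kernel_def using X_in_space by (intro \<Omega>.prob_space_distr) measurable
  show ?thesis
    unfolding cond_prob_wrt_def
  proof (rule real_cond_exp_charact)
    fix A assume A: "A \<in> sets F"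
    then have [measurable]: "A \<in> sets M" using sub by (auto simp: subalgebra_def)
    show "(\<integral>w\<in>A. indicator (X t -` B \<inter> space M) w \<partial>M) = (\<integral>w\<in>A. measure (kernel s t (X s w)) B \<partial>M)"
    proof -
      have "(\<integral>w\<in>A. indicator (X t -` B \<inter> space M) w \<partial>M) =
          enn2real (\<integral>\<^sup>+w. indicator B (X t w) * indicator A w \<partial>M)"
        unfolding set_lebesgue_integral_def
        by (subst integral_eq_nn_integral) (auto intro!: arg_cong[where f=enn2real] nn_integral_cong simp: indicator_def)
      also have "\<dots> = enn2real (\<integral>\<^sup>+w. emeasure (kernel s t (X s w)) B * indicator A w \<partial>M)"
        using nn_integral_X_markov[OF st B subsetD[OF F(2) A]] by simp
      also have "\<dots> = (\<integral>w\<in>A. measure (kernel s t (X s w)) B \<partial>M)"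
        unfolding set_lebesgue_integral_def
        by (subst integral_eq_nn_integral)
          (auto intro!: arg_cong[where f=enn2real] nn_integral_cong simp: indicator_def k.emeasure_eq_measure)
      finally show ?thesis .
    qed
  next
    show "integrable M (\<lambda>w. measure (kernel s t (X s w)) B)"
      by (intro M.integrable_const_bound[where B=1]) auto
    have "X t -` B \<inter> space M \<in> sets M" by measurable
    then show "integrable M (indicator (X t -` B \<inter> space M) :: 'w \<Rightarrow> real)"
      by (intro M.integrable_const_bound[where B=1]) auto
  qed simp_all
qed

lemma X_in_natural_filtration:
  assumes "0 \<le> s"
  shows "X s \<in> natural_filtration M K X s \<rightarrow>\<^sub>M K"
proof (rule measurableI)
  fix B assume "B \<in> sets K"
  then show "X s -` B \<inter> space (natural_filtration M K X s) \<in> sets (natural_filtration M K X s)"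
    using assms unfolding sets_natural_filtration space_natural_filtration
    by (intro sigma_sets.Basic UN_I[of s]) auto
qed simp

lemma vimage_algebra_subset_natural_filtration:
  assumes "0 \<le> s"
  shows "sets (vimage_algebra (space M) (X s) K) \<subseteq> sets (natural_filtration M K X s)"
  using assms unfolding sets_natural_filtration sets_vimage_algebra
  by (intro sigma_sets_mono') (fastforce intro!: bexI[of _ s])

lemma cond_prob_vimage_algebra_X:
  assumes "0 \<le> s" "s \<le> t" "B \<in> sets K"
  shows "AE w in M. cond_prob_wrt M (vimage_algebra (space M) (X s) K) (X t -` B \<inter> space M) w =
    measure (kernel s t (X s w)) B"
  using assms vimage_algebra_subset_natural_filtration
  by (intro cond_prob_X measurable_vimage_algebra1) auto

lemma X_markov_process: "markov_process M K T X"
  unfolding markov_process_def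
proof (intro allI impI ballI)
  fix s t B assume *: "0 \<le> s \<and> s \<le> t \<and> t \<le> T" "B \<in> sets K"
  have "AE w in M. cond_prob_wrt M (natural_filtration M K X s) (X t -` B \<inter> space M) w =
      measure (kernel s t (X s w)) B"
    using * X_in_natural_filtration by (intro cond_prob_X) (auto simp: space_natural_filtration)
  then show "AE w in M. cond_prob_wrt M (natural_filtration M K X s) (X t -` B \<inter> space M) w =
      cond_prob_wrt M (vimage_algebra (space M) (X s) K) (X t -` B \<inter> space M) w"
    using cond_prob_vimage_algebra_X[of s t B] * by auto
qed

lemma X_transition_function: "transition_function M K T X kernel"
  unfolding transition_function_def
  by (auto intro!: cond_prob_vimage_algebra_X chapman_kolmogorov)

end

text \<open>A stream of pairs is interleaved into one real sequence, gaps at even and marks at odd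
  positions. Since \<open>dec\<close> undoes \<open>enc\<close>, decoding the image of
  \<open>\<Omega>\<close> gives \<open>\<Omega>\<close> back.\<close>

lemma (in jump_flow) ex_noise:
  "\<exists>(M :: (nat \<Rightarrow> real) measure) D. prob_space M \<and> D \<in> M \<rightarrow>\<^sub>M \<Omega> \<and> distr M \<Omega> D = \<Omega>"
proof -
  define enc :: "(real \<times> real) stream \<Rightarrow> nat \<Rightarrow> real" where
    "enc \<omega> n = (if even n then fst (\<omega> !! (n div 2)) else snd (\<omega> !! (n div 2)))" for \<omega> n
  define dec :: "(nat \<Rightarrow> real) \<Rightarrow> (real \<times> real) stream" where
    "dec f = to_stream (\<lambda>n. (f (2 * n), f (2 * n + 1)))" for f
  let ?P = "\<Pi>\<^sub>M n\<in>(UNIV :: nat set). (borel :: real measure)"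
  have snth [measurable]: "(\<lambda>\<omega>. \<omega> !! n) \<in> \<Omega> \<rightarrow>\<^sub>M borel \<Otimes>\<^sub>M borel" for n
    using measurable_snth[of n \<nu>] unfolding \<Omega>_def by (simp cong: measurable_cong_sets add: sets_\<nu>)
  have [measurable]: "enc \<in> \<Omega> \<rightarrow>\<^sub>M ?P"
    unfolding enc_def[abs_def] by (rule measurable_PiM_single') (auto simp: space_PiM)
  have [measurable]: "dec \<in> ?P \<rightarrow>\<^sub>M \<Omega>"
    unfolding \<Omega>_def dec_def[abs_def]
    by (rule measurable_stream_space2) (simp add: to_stream_def cong: measurable_cong_sets add: sets_\<nu>)
  have "dec (enc \<omega>) = \<omega>" for \<omega>
    by (simp add: dec_def enc_def to_stream_def stream_smap_nats[symmetric])
  then have "distr (distr \<Omega> ?P enc) \<Omega> dec = \<Omega>"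
    by (subst distr_distr) (simp_all add: comp_def distr_id2)
  moreover have "prob_space (distr \<Omega> ?P enc)" by (rule \<Omega>.prob_space_distr) measurable
  ultimately show ?thesis by (intro exI[of _ "distr \<Omega> ?P enc"] exI[of _ dec]) simp
qed

section \<open>Solution operators\<close>

text \<open>Approximates s by grid points strictly to its right. The countable range reduces
  measurability in s to fixed times, and the right-hand side is needed because a solution started at
  s can be compared only with solutions started later.\<close>

definition round_up :: "nat \<Rightarrow> real \<Rightarrow> real" where
  "round_up n s = (of_int \<lfloor>real (Suc n) * s\<rfloor> + 1) / real (Suc n)"

lemma round_up_bounds: "s \<le> round_up n s" "round_up n s \<le> s + 1 / real (Suc n)"
proof -
  have "real (Suc n) * s / real (Suc n) \<le> round_up n s"
    unfolding round_up_def by (intro divide_right_mono) linarith+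
  then show "s \<le> round_up n s" by simp
  have "round_up n s \<le> (real (Suc n) * s + 1) / real (Suc n)"
    unfolding round_up_def by (intro divide_right_mono) linarith+
  then show "round_up n s \<le> s + 1 / real (Suc n)" by (simp add: add_divide_distrib)
qed

lemma round_up_tendsto: "(\<lambda>n. round_up n s) \<longlonglongrightarrow> s"
proof (rule tendsto_sandwich[where f="\<lambda>_. s" and h="\<lambda>n. s + 1 / real (Suc n)"])
  show "(\<lambda>n. s + 1 / real (Suc n)) \<longlonglongrightarrow> s"
    using tendsto_add[OF tendsto_const LIMSEQ_Suc[OF lim_1_over_n]] by simp
qed (simp_all only: round_up_bounds eventually_True tendsto_const)

text \<open>
  No separability of the state space is available, so joint continuity would not yield measurability
  with respect to the product \<open>\<sigma>\<close>-algebra; continuity from the right in the time arguments alone does.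
\<close>

lemma borel_measurable_right_continuous:
  fixes F :: "real \<Rightarrow> real \<Rightarrow> 'a \<Rightarrow> 'b :: metric_space"
  assumes F: "\<And>s t. F s t \<in> borel_measurable N"
    and lim: "\<And>s t x. x \<in> space N \<Longrightarrow> (\<lambda>n. F (round_up n s) (round_up n t) x) \<longlonglongrightarrow> F s t x"
  shows "(\<lambda>(s, t, x). F s t x) \<in> borel_measurable (borel \<Otimes>\<^sub>M borel \<Otimes>\<^sub>M N)"
proof (rule borel_measurable_LIMSEQ_metric)
  fix n
  let ?f = "\<lambda>s. \<lfloor>real (Suc n) * s\<rfloor>" and ?g = "\<lambda>i::int. (of_int i + 1) / real (Suc n)"
  have "(\<lambda>z. (\<lambda>(i, j) z. F (?g i) (?g j) (snd (snd z))) (?f (fst z), ?f (fst (snd z))) z)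
      \<in> borel_measurable (borel \<Otimes>\<^sub>M borel \<Otimes>\<^sub>M N)"
  proof (rule measurable_compose_countable)
    fix i :: "int \<times> int"
    show "(\<lambda>(i, j) z. F (?g i) (?g j) (snd (snd z))) i \<in> borel_measurable (borel \<Otimes>\<^sub>M borel \<Otimes>\<^sub>M N)"
      using measurable_compose[OF measurable_compose[OF measurable_snd measurable_snd] F]
      by (cases i) (simp only: prod.case)
  next
    have "(\<lambda>z. (?f (fst z), ?f (fst (snd z)))) \<in> borel \<Otimes>\<^sub>M borel \<Otimes>\<^sub>M N \<rightarrow>\<^sub>M count_space UNIV \<Otimes>\<^sub>M count_space UNIV"
      by measurable
    then show "(\<lambda>z. (?f (fst z), ?f (fst (snd z)))) \<in> borel \<Otimes>\<^sub>M borel \<Otimes>\<^sub>M N \<rightarrow>\<^sub>M count_space UNIV"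
      by (simp add: pair_measure_countable)
  qed
  then show "(\<lambda>(s, t, x). F (round_up n s) (round_up n t) x) \<in> borel_measurable (borel \<Otimes>\<^sub>M borel \<Otimes>\<^sub>M N)"
    by (simp add: round_up_def split_def)
qed (use lim in \<open>auto simp: space_pair_measure\<close>)

lemma open_singleton_vec: "open {r :: nat ^ 'n::finite}"
  unfolding open_vec_def
  by (auto intro!: exI[of _ "\<lambda>i. {r $ i}"] Topological_Spaces.open_discrete simp: vec_eq_iff)

lemma norm_le_load_norm: "norm u \<le> load_norm u"
proof -
  have "norm u \<le> norm (fst u) + norm (snd u)" using norm_Pair_le[of "fst u" "snd u"] by simp
  also have "\<dots> \<le> (\<Sum>e\<in>UNIV. norm (fst u $ e)) + (\<Sum>e\<in>UNIV. norm (snd u $ e))"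
    unfolding norm_vec_def by (intro add_mono L2_set_le_sum) auto
  also have "\<dots> = load_norm u" by (simp add: load_norm_def sum.distrib)
  finally show ?thesis .
qed

lemma load_norm_tendsto_0:
  assumes "(f \<longlongrightarrow> u) F" shows "((\<lambda>x. load_norm (u - f x)) \<longlongrightarrow> 0) F"
proof -
  have "((\<lambda>x. load_norm (u - f x)) \<longlongrightarrow> load_norm (u - u)) F"
    unfolding load_norm_def using assms by (intro tendsto_intros) auto
  then show ?thesis by (simp add: load_norm_def)
qed

lemma load_norm_minus: "load_norm (u - v) = load_norm (v - u)"
  unfolding load_norm_def by (simp add: norm_minus_commute abs_minus_commute)

section \<open>Regularity of a solution operator\<close>

context
  fixes P :: "('v, 'e::finite) production_network" and m and S
  assumes S: "solution_operator P m S"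
begin

lemmas solution_axioms = S[unfolded solution_operator_def]

lemma solution_in_load_space:
  "0 \<le> s \<Longrightarrow> s \<le> t \<Longrightarrow> t \<le> horizon P \<Longrightarrow> u \<in> load_space P \<Longrightarrow> S s t u \<in> load_space P"
  using solution_axioms[THEN conjunct1, rule_format] by blast

lemma solution_refl: "0 \<le> s \<Longrightarrow> s \<le> horizon P \<Longrightarrow> u \<in> load_space P \<Longrightarrow> S s s u = u"
  using solution_axioms[THEN conjunct2, THEN conjunct1, rule_format] by simp

lemma solution_trans:
  "0 \<le> s \<Longrightarrow> s \<le> t \<Longrightarrow> t \<le> t' \<Longrightarrow> t' \<le> horizon P \<Longrightarrow> u \<in> load_space P \<Longrightarrow> S t t' (S s t u) = S s t' u"
  using solution_axioms[THEN conjunct2, THEN conjunct2, THEN conjunct1, rule_format] by simp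

lemma solution_nonexpansive:
  "0 \<le> s \<Longrightarrow> s \<le> t \<Longrightarrow> t \<le> horizon P \<Longrightarrow> u \<in> load_space P \<Longrightarrow> u' \<in> load_space P \<Longrightarrow>
    load_norm (S s t u - S s t u') \<le> load_norm (u - u')"
  using solution_axioms[THEN conjunct2, THEN conjunct2, THEN conjunct2, THEN conjunct2, THEN conjunct1, rule_format] by simp

lemma solution_continuous_time:
  "0 \<le> s \<Longrightarrow> s \<le> horizon P \<Longrightarrow> u \<in> load_space P \<Longrightarrow> continuous_on {s..horizon P} (\<lambda>t. S s t u)"
  using solution_axioms[THEN conjunct2, THEN conjunct2, THEN conjunct2, THEN conjunct1, rule_format] by simp

lemma solution_continuous_load:
  assumes "0 \<le> s" "s \<le> t" "t \<le> horizon P"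
  shows "continuous_on (load_space P) (S s t)"
  unfolding continuous_on
proof
  fix u assume u: "u \<in> load_space P"
  have "((\<lambda>v. S s t v - S s t u) \<longlongrightarrow> 0) (at u within load_space P)"
  proof (rule Lim_null_comparison)
    show "\<forall>\<^sub>F v in at u within load_space P. norm (S s t v - S s t u) \<le> load_norm (u - v)"
      unfolding eventually_at_filter
    proof (intro always_eventually allI impI)
      fix v assume "v \<in> load_space P"
      then show "norm (S s t v - S s t u) \<le> load_norm (u - v)"
        using norm_le_load_norm[of "S s t v - S s t u"] solution_nonexpansive[OF assms _ u, of v]
        by (simp add: load_norm_minus[of u])
    qed
  qed (rule load_norm_tendsto_0[OF tendsto_ident_at])
  then show "(S s t \<longlongrightarrow> S s t u) (at u within load_space P)" by (simp add: LIM_zero_iff)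
qed

text \<open>Continuity in the starting time is not among the axioms. As \<open>S s (b n) u\<close>
  is \<open>S (a n) (b n)\<close> applied to \<open>S s (a n) u\<close>, nonexpansiveness bounds the
  effect of starting from u at \<open>a n\<close> instead of s by the distance of u to
  \<open>S s (a n) u\<close>, which vanishes by continuity in the end time. This works for s \<le>
  \<open>a n\<close>, so from the right only.\<close>

lemma solution_right_continuous:
  assumes u: "u \<in> load_space P" and "0 \<le> s" "s \<le> t" "t \<le> horizon P"
    and ab: "\<And>n. s \<le> a n" "\<And>n. a n \<le> b n" "\<And>n. b n \<le> horizon P" and a: "a \<longlonglongrightarrow> s" and b: "b \<longlonglongrightarrow> t"
  shows "(\<lambda>n. S (a n) (b n) u) \<longlonglongrightarrow> S s t u"
proof -
  have lim: "(\<lambda>n. S s (c n) u) \<longlonglongrightarrow> S s r u"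
    if "c \<longlonglongrightarrow> r" "\<And>n. s \<le> c n" "\<And>n. c n \<le> horizon P" "s \<le> r" "r \<le> horizon P" for c r
    by (rule continuous_on_tendsto_compose[OF solution_continuous_time that(1)]) (use that assms in auto)
  have "(\<lambda>n. S s (a n) u) \<longlonglongrightarrow> u"
    using lim[OF a ab(1)] solution_refl[of s u] assms order_trans[OF ab(2,3)] by simp
  then have "(\<lambda>n. load_norm (u - S s (a n) u)) \<longlonglongrightarrow> 0" by (rule load_norm_tendsto_0)
  then have "(\<lambda>n. S (a n) (b n) u - S s (b n) u) \<longlonglongrightarrow> 0"
  proof (rule Lim_null_comparison[rotated], intro always_eventually allI)
    fix n
    have an: "s \<le> a n" "a n \<le> b n" "b n \<le> horizon P" using ab by auto
    have "norm (S (a n) (b n) u - S s (b n) u) \<le> load_norm (S (a n) (b n) u - S (a n) (b n) (S s (a n) u))"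
      unfolding solution_trans[OF assms(2) an u] by (rule norm_le_load_norm)
    also have "\<dots> \<le> load_norm (u - S s (a n) u)"
      using an u assms(2) by (intro solution_nonexpansive solution_in_load_space) auto
    finally show "norm (S (a n) (b n) u - S s (b n) u) \<le> load_norm (u - S s (a n) u)" .
  qed
  moreover have "(\<lambda>n. S s (b n) u) \<longlonglongrightarrow> S s t u"
    using lim[OF b order_trans[OF ab(1,2)] ab(3)] assms by simp
  ultimately show ?thesis using tendsto_add by fastforce
qed

end

section \<open>The production network model\<close>

locale production_model =
  fixes P :: "('v, 'e::finite) production_network"
    and S :: "real ^ 'e \<Rightarrow> real \<Rightarrow> real \<Rightarrow> 'e load \<Rightarrow> 'e load"
    and C :: "'e \<Rightarrow> nat"
    and \<mu> :: "'e \<Rightarrow> nat \<Rightarrow> real"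
    and rate :: "'e \<Rightarrow> nat \<Rightarrow> nat \<Rightarrow> real \<Rightarrow> real \<Rightarrow> l1 \<Rightarrow> real"
    and rate_bound :: "'e \<Rightarrow> real"
    and x0 :: "'e state"
  assumes network: "is_production_network P"
    and solution: "\<And>m. (\<And>e. 0 \<le> m $ e) \<Longrightarrow> solution_operator P m (S m)"
    and capacity_nonneg: "\<And>e i. i \<in> {1..C e} \<Longrightarrow> 0 \<le> \<mu> e i"
    and rates_continuous: "\<And>e i j. i \<in> {1..C e} \<Longrightarrow> j \<in> {1..C e} \<Longrightarrow>
      continuous_on ({0..horizon P} \<times> {0..} \<times> L1_interval (lo P e) (hi P e))
        (\<lambda>(t, q, \<rho>). rate e i j t q \<rho>)"
    and rates_nonneg: "\<And>e i j t q \<rho>. i \<in> {1..C e} \<Longrightarrow> j \<in> {1..C e} \<Longrightarrow>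
      t \<in> {0..horizon P} \<Longrightarrow> 0 \<le> q \<Longrightarrow> \<rho> \<in> L1_interval (lo P e) (hi P e) \<Longrightarrow>
      0 \<le> rate e i j t q \<rho>"
    and rates_diag: "\<And>e i t q \<rho>. i \<in> {1..C e} \<Longrightarrow>
      t \<in> {0..horizon P} \<Longrightarrow> 0 \<le> q \<Longrightarrow> \<rho> \<in> L1_interval (lo P e) (hi P e) \<Longrightarrow>
      rate e i i t q \<rho> = (\<Sum>j\<in>{1..C e} - {i}. rate e i j t q \<rho>)"
    and rates_bounded: "\<And>e i j t q \<rho>. i \<in> {1..C e} \<Longrightarrow> j \<in> {1..C e} \<Longrightarrow>
      t \<in> {0..horizon P} \<Longrightarrow> 0 \<le> q \<Longrightarrow> \<rho> \<in> L1_interval (lo P e) (hi P e) \<Longrightarrow>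
      rate e i j t q \<rho> \<le> rate_bound e"
    and initial: "x0 \<in> state_space P C"
begin

section \<open>Measurable structure of the state space and the flow\<close>

abbreviation "T \<equiv> horizon P"
abbreviation "K \<equiv> state_measure P C"

definition levels :: "(nat ^ 'e) set" where
  "levels = {r. \<forall>e. r $ e \<in> {1..C e}}"

definition load_measure :: "'e load measure" where
  "load_measure = restrict_space borel (load_space P)"

definition clamp_time :: "real \<Rightarrow> real" where
  "clamp_time t = max 0 (min T t)"

lemma horizon_pos: "0 < T"
  using network by (simp add: is_production_network_def)

lemma clamp_time_bounds [simp]: "0 \<le> clamp_time t" "clamp_time t \<le> T"
  using horizon_pos by (simp_all add: clamp_time_def)

lemma clamp_time_mono: "s \<le> t \<Longrightarrow> clamp_time s \<le> clamp_time t"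
  by (simp add: clamp_time_def)

lemma clamp_time_eq [simp]: "0 \<le> t \<Longrightarrow> t \<le> T \<Longrightarrow> clamp_time t = t"
  by (simp add: clamp_time_def)

lemma clamp_time_tendsto: "(f \<longlongrightarrow> t) F \<Longrightarrow> ((\<lambda>x. clamp_time (f x)) \<longlongrightarrow> clamp_time t) F"
  unfolding clamp_time_def by (intro tendsto_intros)

lemma space_K: "space K = levels \<times> load_space P"
  by (simp add: state_measure_def space_restrict_space state_space_def levels_def)

lemma space_load_measure: "space load_measure = load_space P"
  by (simp add: load_measure_def space_restrict_space)

lemma finite_levels: "finite levels"
proof -
  have "levels \<subseteq> vec_lambda ` (PiE UNIV (\<lambda>e. {1..C e}))"
  proof
    fix r assume "r \<in> levels"
    then show "r \<in> vec_lambda ` (PiE UNIV (\<lambda>e. {1..C e}))"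
      by (intro image_eqI[of _ _ "vec_nth r"]) (auto simp: levels_def)
  qed
  then show ?thesis by (rule finite_subset) (intro finite_imageI finite_PiE, auto)
qed

lemma measurable_fst_K [measurable]: "fst \<in> K \<rightarrow>\<^sub>M count_space levels"
proof (subst measurable_count_space_eq2[OF finite_levels], intro conjI ballI)
  fix r
  have "open (fst -` {r} :: 'e state set)" by (intro open_vimage_fst open_singleton_vec)
  then show "fst -` {r} \<inter> space K \<in> sets K"
    unfolding state_measure_def space_restrict_space sets_restrict_space by (auto intro: borel_open)
qed (auto simp: space_K)

lemma measurable_snd_K [measurable]: "snd \<in> K \<rightarrow>\<^sub>M load_measure"
  unfolding load_measure_def
proof (rule measurable_restrict_space2)
  show "snd \<in> borel_measurable K"
    unfolding state_measure_def
    by (intro borel_measurable_continuous_on_restrict continuous_intros)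
qed (auto simp: space_K)

text \<open>With finitely many levels, measurability may be checked with the level frozen. Only maps
  on loads remain, and the Borel structure of the product never has to be compared with a product of
  Borel structures.\<close>

lemma measurable_by_level:
  assumes "g \<in> N \<rightarrow>\<^sub>M count_space levels" "\<And>r. r \<in> levels \<Longrightarrow> f r \<in> N \<rightarrow>\<^sub>M N'"
  shows "(\<lambda>x. f (g x) x) \<in> N \<rightarrow>\<^sub>M N'"
  by (rule measurable_compose_countable'[OF assms(2,1) countable_finite[OF finite_levels]])

lemma measurable_Pair_K [measurable (raw)]:
  assumes f: "f \<in> N \<rightarrow>\<^sub>M count_space levels" and g: "g \<in> N \<rightarrow>\<^sub>M load_measure"
  shows "(\<lambda>x. (f x, g x)) \<in> N \<rightarrow>\<^sub>M K"
proof (rule measurable_by_level[OF f])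
  fix r assume r: "r \<in> levels"
  have "(\<lambda>u. (r, u)) \<in> load_measure \<rightarrow>\<^sub>M K"
    unfolding state_measure_def
  proof (rule measurable_restrict_space2)
    show "(\<lambda>u. (r, u)) \<in> borel_measurable load_measure"
      unfolding load_measure_def
      by (intro borel_measurable_continuous_on_restrict continuous_intros)
  qed (use r in \<open>auto simp: space_load_measure state_space_def levels_def\<close>)
  from measurable_compose[OF g this] show "(\<lambda>x. (r, g x)) \<in> N \<rightarrow>\<^sub>M K" .
qed

lemma solution_level: "r \<in> levels \<Longrightarrow> solution_operator P (capacity_vector \<mu> r) (S (capacity_vector \<mu> r))"
  using capacity_nonneg by (intro solution) (auto simp: capacity_vector_def levels_def)

text \<open>
  Clamping all times to \<open>[0,T]\<close> turns the solution operators into a flow indexed by all real times.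
\<close>

definition load_flow :: "nat ^ 'e \<Rightarrow> real \<Rightarrow> real \<Rightarrow> 'e load \<Rightarrow> 'e load" where
  "load_flow r s t u = S (capacity_vector \<mu> r) (clamp_time s) (clamp_time (max s t)) u"

definition flow :: "real \<Rightarrow> real \<Rightarrow> 'e state \<Rightarrow> 'e state" where
  "flow s t x = (fst x, load_flow (fst x) s t (snd x))"

lemma load_flow_in_load_space: "r \<in> levels \<Longrightarrow> u \<in> load_space P \<Longrightarrow> load_flow r s t u \<in> load_space P"
  unfolding load_flow_def by (rule solution_in_load_space[OF solution_level]) (auto intro: clamp_time_mono)

lemma measurable_load_flow:
  assumes r: "r \<in> levels"
  shows "(\<lambda>(s, t, u). load_flow r s t u) \<in> borel \<Otimes>\<^sub>M borel \<Otimes>\<^sub>M load_measure \<rightarrow>\<^sub>M load_measure"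
proof -
  note sol = solution_level[OF r]
  have "(\<lambda>(s, t, u). load_flow r s t u) \<in> borel_measurable (borel \<Otimes>\<^sub>M borel \<Otimes>\<^sub>M load_measure)"
  proof (rule borel_measurable_right_continuous)
    fix s t
    show "load_flow r s t \<in> borel_measurable load_measure"
      unfolding load_measure_def load_flow_def[abs_def]
      by (intro borel_measurable_continuous_on_restrict solution_continuous_load[OF sol])
        (auto intro: clamp_time_mono)
    fix u assume "u \<in> space load_measure"
    then show "(\<lambda>n. load_flow r (round_up n s) (round_up n t) u) \<longlonglongrightarrow> load_flow r s t u"
      unfolding load_flow_def
      by (intro solution_right_continuous[OF sol] clamp_time_tendsto tendsto_max round_up_tendsto
          clamp_time_bounds clamp_time_mono max.cobounded1 round_up_bounds)
        (simp add: space_load_measure)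
  qed
  then show ?thesis
    unfolding load_measure_def
    by (intro measurable_restrict_space2)
      (auto simp: space_pair_measure load_measure_def[symmetric] space_load_measure load_flow_in_load_space[OF r])
qed

lemma measurable_flow_K: "(\<lambda>(s, t, x). flow s t x) \<in> borel \<Otimes>\<^sub>M borel \<Otimes>\<^sub>M K \<rightarrow>\<^sub>M K"
proof -
  have "(\<lambda>z. load_flow (fst (snd (snd z))) (fst z) (fst (snd z)) (snd (snd (snd z))))
      \<in> borel \<Otimes>\<^sub>M borel \<Otimes>\<^sub>M K \<rightarrow>\<^sub>M load_measure"
  proof (rule measurable_by_level[where f="\<lambda>r z. load_flow r (fst z) (fst (snd z)) (snd (snd (snd z)))"])
    fix r assume "r \<in> levels"
    from measurable_compose[OF _ measurable_load_flow[OF this],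
        of "\<lambda>z. (fst z, fst (snd z), snd (snd (snd z)))" "borel \<Otimes>\<^sub>M borel \<Otimes>\<^sub>M K"]
    show "(\<lambda>z. load_flow r (fst z) (fst (snd z)) (snd (snd (snd z)))) \<in> borel \<Otimes>\<^sub>M borel \<Otimes>\<^sub>M K \<rightarrow>\<^sub>M load_measure"
      by simp
  qed measurable
  then show ?thesis unfolding flow_def split_beta by measurable
qed

lemma flow_flow_K:
  assumes "x \<in> space K" "s \<le> t" "t \<le> u"
  shows "flow t u (flow s t x) = flow s u x"
  using assms unfolding flow_def load_flow_def
  by (auto simp: space_K max_absorb2 intro!: solution_trans[OF solution_level] clamp_time_mono)

lemma flow_refl_K: "x \<in> space K \<Longrightarrow> flow s s x = x"
  unfolding flow_def load_flow_def
  by (auto simp: space_K intro!: solution_refl[OF solution_level])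

section \<open>Transition rates as functions of time and state\<close>

definition intensity :: "'e \<Rightarrow> nat \<Rightarrow> real \<Rightarrow> 'e state \<Rightarrow> real" where
  "intensity e j t x = rate e (fst x $ e) j (clamp_time t) (fst (snd x) $ e) (snd (snd x) $ e)"

lemma intensity_tendsto:
  assumes "r \<in> levels" "j \<in> {1..C e}" "u \<in> load_space P" "\<forall>\<^sub>F y in F. g y \<in> load_space P"
    and "(f \<longlongrightarrow> t) F" "(g \<longlongrightarrow> u) F"
  shows "((\<lambda>y. intensity e j (f y) (r, g y)) \<longlongrightarrow> intensity e j t (r, u)) F"
proof -
  let ?D = "{0..T} \<times> {0..} \<times> L1_interval (lo P e) (hi P e)"
  have "((\<lambda>y. (\<lambda>(t, q, \<rho>). rate e (r $ e) j t q \<rho>) (clamp_time (f y), fst (g y) $ e, snd (g y) $ e))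
      \<longlongrightarrow> (\<lambda>(t, q, \<rho>). rate e (r $ e) j t q \<rho>) (clamp_time t, fst u $ e, snd u $ e)) F"
  proof (rule continuous_on_tendsto_compose[OF rates_continuous])
    show "((\<lambda>y. (clamp_time (f y), fst (g y) $ e, snd (g y) $ e)) \<longlongrightarrow> (clamp_time t, fst u $ e, snd u $ e)) F"
      using assms by (intro tendsto_intros clamp_time_tendsto)
    show "(clamp_time t, fst u $ e, snd u $ e) \<in> ?D"
      using assms(3) by (auto simp: load_space_def)
    show "\<forall>\<^sub>F y in F. (clamp_time (f y), fst (g y) $ e, snd (g y) $ e) \<in> ?D"
      using assms(4) by eventually_elim (auto simp: load_space_def)
  qed (use assms in \<open>auto simp: levels_def\<close>)
  then show ?thesis by (simp add: intensity_def)
qed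

lemma measurable_intensity:
  assumes j: "j \<in> {1..C e}"
  shows "(\<lambda>(t, x). intensity e j t x) \<in> borel_measurable (borel \<Otimes>\<^sub>M K)"
proof -
  \<comment> \<open>The first time argument is a dummy that matches the two time arguments of
    \<open>borel_measurable_right_continuous\<close>.\<close>
  have "(\<lambda>(s :: real, t, u). intensity e j t (r, u)) \<in> borel_measurable (borel \<Otimes>\<^sub>M borel \<Otimes>\<^sub>M load_measure)"
    if r: "r \<in> levels" for r
  proof (rule borel_measurable_right_continuous[where F="\<lambda>s t u. intensity e j t (r, u)"])
    fix t :: real
    have "continuous_on (load_space P) (\<lambda>u. intensity e j t (r, u))"
      unfolding continuous_on using j r
      by (intro ballI intensity_tendsto) (auto simp: eventually_at_filter)
    then show "(\<lambda>u. intensity e j t (r, u)) \<in> borel_measurable load_measure"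
      unfolding load_measure_def by (rule borel_measurable_continuous_on_restrict)
    fix u assume "u \<in> space load_measure"
    then show "(\<lambda>n. intensity e j (round_up n t) (r, u)) \<longlonglongrightarrow> intensity e j t (r, u)"
      using r j by (intro intensity_tendsto round_up_tendsto) (auto simp: space_load_measure)
  qed
  note * = measurable_compose[OF _ this]
  have "(\<lambda>z. intensity e j (fst z) (fst (snd z), snd (snd z))) \<in> borel_measurable (borel \<Otimes>\<^sub>M K)"
  proof (rule measurable_by_level[where f="\<lambda>r z. intensity e j (fst z) (r, snd (snd z))"])
    fix r assume "r \<in> levels"
    from *[OF _ this, of "\<lambda>z. (0, fst z, snd (snd z))" "borel \<Otimes>\<^sub>M K"]
    show "(\<lambda>z. intensity e j (fst z) (r, snd (snd z))) \<in> borel_measurable (borel \<Otimes>\<^sub>M K)" by simp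
  qed measurable
  then show ?thesis by (simp add: split_beta)
qed

section \<open>Proposals and their acceptance\<close>

definition moves :: "('e \<times> nat) set" where
  "moves = (SIGMA e:UNIV. {1..C e})"

definition move :: "nat \<Rightarrow> 'e \<times> nat" where
  "move = (SOME f. bij_betw f {0..<card moves} moves)"

text \<open>The absolute values make the sum dominate each \<open>rate_bound e\<close> whatever the
  signs. The summand 1 makes it positive and strictly larger than every intensity, so that the marks
  accepting a move stay inside its unit cell.\<close>

definition ceiling_rate :: real where
  "ceiling_rate = 1 + (\<Sum>e\<in>UNIV. \<bar>rate_bound e\<bar>)"

text \<open>
  A mark \<open>m\<close> proposes the move numbered \<open>\<lfloor>m\<rfloor>\<close>, which its fractional part accepts with probability
  proportional to the rate of the move.
\<close>

definition jump :: "real \<Rightarrow> 'e state \<Rightarrow> real \<Rightarrow> 'e state" where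
  "jump t x m =
    (let (e, j) = move (nat \<lfloor>m\<rfloor>) in
     if 0 \<le> m \<and> m < real (card moves) \<and> (m - of_int \<lfloor>m\<rfloor>) * ceiling_rate < intensity e j t x
     then (\<chi> e'. if e' = e then j else fst x $ e', snd x) else x)"

definition mark_measure :: "real measure" where
  "mark_measure = uniform_measure lborel {0..<real (card moves)}"

lemma finite_moves: "finite moves"
  by (simp add: moves_def)

lemma card_moves_pos: "0 < card moves"
proof -
  have "fst x0 $ e \<in> {1..C e}" for e using initial by (auto simp: state_space_def)
  then have "(e, fst x0 $ e) \<in> moves" for e unfolding moves_def by blast
  then show ?thesis using finite_moves card_gt_0_iff by blast
qed

lemma bij_move: "bij_betw move {0..<card moves} moves"
  using ex_bij_betw_nat_finite[OF finite_moves] unfolding move_def by (rule someI_ex)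

lemma ceiling_rate_pos: "0 < ceiling_rate"
  unfolding ceiling_rate_def by (rule add_pos_nonneg) (auto intro: sum_nonneg)

lemma intensity_bounds:
  assumes "x \<in> space K" "j \<in> {1..C e}"
  shows "0 \<le> intensity e j t x" "intensity e j t x < ceiling_rate"
proof -
  have *: "fst x $ e \<in> {1..C e}" "0 \<le> fst (snd x) $ e" "snd (snd x) $ e \<in> L1_interval (lo P e) (hi P e)"
    using assms(1) by (auto simp: space_K levels_def load_space_def)
  then show "0 \<le> intensity e j t x"
    unfolding intensity_def using assms(2) by (intro rates_nonneg) auto
  have "intensity e j t x \<le> rate_bound e"
    unfolding intensity_def using * assms(2) by (intro rates_bounded) auto
  also have "\<dots> \<le> (\<Sum>e\<in>UNIV. \<bar>rate_bound e\<bar>)"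
    using member_le_sum[of e UNIV "\<lambda>e. \<bar>rate_bound e\<bar>"] by simp
  finally show "intensity e j t x < ceiling_rate" by (simp add: ceiling_rate_def)
qed

lemma prob_mark_measure: "prob_space mark_measure"
  unfolding mark_measure_def using card_moves_pos by (intro prob_space_uniform_measure) auto

lemma measurable_jump_K: "(\<lambda>(t, x, m). jump t x m) \<in> borel \<Otimes>\<^sub>M K \<Otimes>\<^sub>M borel \<rightarrow>\<^sub>M K"
proof -
  define step where "step k z = (let (e, j) = move k; t = fst z; x = fst (snd z); m = snd (snd z) in
     if 0 \<le> m \<and> m < real (card moves) \<and> (m - of_int \<lfloor>m\<rfloor>) * ceiling_rate < intensity e j t x
     then (\<chi> e'. if e' = e then j else fst x $ e', snd x) else x)" for k and z :: "real \<times> 'e state \<times> real"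
  let ?N = "borel \<Otimes>\<^sub>M K \<Otimes>\<^sub>M (borel :: real measure)"
  have "step k \<in> ?N \<rightarrow>\<^sub>M K" if "k < card moves" for k
  proof -
    obtain e j where ej: "move k = (e, j)" by fastforce
    have "move k \<in> moves" using bij_betwE[OF bij_move] that by simp
    then have j: "j \<in> {1..C e}" by (simp add: ej moves_def)
    have [measurable]: "(\<lambda>z. intensity e j (fst z) (fst (snd z))) \<in> borel_measurable ?N"
      using measurable_compose[OF _ measurable_intensity[OF j], of "\<lambda>z. (fst z, fst (snd z))" ?N] by simp
    have [measurable]: "(\<lambda>z. \<chi> e'. if e' = e then j else fst (fst (snd z)) $ e') \<in> ?N \<rightarrow>\<^sub>M count_space levels"
    proof (rule measurable_compose[of "\<lambda>z. fst (fst (snd z))" ?N "count_space levels"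
          "\<lambda>r. \<chi> e'. if e' = e then j else r $ e'"])
      show "(\<lambda>z. fst (fst (snd z))) \<in> ?N \<rightarrow>\<^sub>M count_space levels" by measurable
    qed (use j in \<open>auto simp: levels_def\<close>)
    show ?thesis unfolding step_def[abs_def] ej Let_def prod.case by measurable
  qed
  \<comment> \<open>Beyond the numbered moves the value of \<open>move\<close> is arbitrary, so the
    identity is put there; \<open>jump\<close> behaves in the same way because it rejects marks
    outside the range.\<close>
  then have "(\<lambda>z. if k < card moves then step k z else fst (snd z)) \<in> ?N \<rightarrow>\<^sub>M K" for k
    by (cases "k < card moves") (simp_all only: if_True if_False, measurable)
  then have "(\<lambda>z. (\<lambda>k z. if k < card moves then step k z else fst (snd z)) (nat \<lfloor>snd (snd z)\<rfloor>) z) \<in> ?N \<rightarrow>\<^sub>M K"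
    by (rule measurable_compose_countable) measurable
  moreover have "(\<lambda>z. (\<lambda>k z. if k < card moves then step k z else fst (snd z)) (nat \<lfloor>snd (snd z)\<rfloor>) z) =
      (\<lambda>(t, x, m). jump t x m)"
  proof (rule ext)
    fix z :: "real \<times> 'e state \<times> real"
    obtain t x m where z: "z = (t, x, m)" by (metis surj_pair)
    obtain e j where ej: "move (nat \<lfloor>m\<rfloor>) = (e, j)" by fastforce
    have "step (nat \<lfloor>m\<rfloor>) z = jump t x m" by (simp only: step_def jump_def Let_def z fst_conv snd_conv)
    moreover have "jump t x m = x" if "\<not> nat \<lfloor>m\<rfloor> < card moves"
    proof -
      have "\<not> (0 \<le> m \<and> m < real (card moves))" using that by linarith
      then show ?thesis by (simp only: jump_def Let_def ej prod.case) auto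
    qed
    ultimately show "(\<lambda>k z. if k < card moves then step k z else fst (snd z)) (nat \<lfloor>snd (snd z)\<rfloor>) z =
        (case z of (t, x, m) \<Rightarrow> jump t x m)"
      by (simp only: z fst_conv snd_conv prod.case split: if_split) auto
  qed
  ultimately show ?thesis by (simp only:)
qed

text \<open>A tick proposes a given move with probability 1 / \<open>card moves\<close> and accepts
  it with probability intensity / \<open>ceiling_rate\<close>; at this clock rate the move is
  carried out at exactly its intensity.\<close>

definition clock_rate :: real where
  "clock_rate = real (card moves) * ceiling_rate"

lemma clock_rate_pos: "0 < clock_rate"
  using card_moves_pos ceiling_rate_pos by (simp add: clock_rate_def)

sublocale jump_flow K mark_measure clock_rate flow jump
proof (rule jump_flow.intro)
  show "sets mark_measure = sets borel" by (simp add: mark_measure_def)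
qed (rule prob_mark_measure clock_rate_pos measurable_flow_K measurable_jump_K flow_flow_K flow_refl_K; assumption?)+

section \<open>Transition probabilities at one tick\<close>

definition level_event :: "'e \<Rightarrow> nat \<Rightarrow> 'e state set" where
  "level_event e j = {y \<in> space K. fst y $ e = j}"

lemma sets_level_event [measurable]: "level_event e j \<in> sets K"
proof -
  have "fst -` {r \<in> levels. r $ e = j} \<inter> space K \<in> sets K"
    by (rule measurable_sets[OF measurable_fst_K]) simp
  also have "fst -` {r \<in> levels. r $ e = j} \<inter> space K = level_event e j"
    by (auto simp: level_event_def space_K)
  finally show ?thesis .
qed

lemma sets_jump_event [measurable]:
  assumes "x \<in> space K"
  shows "{m. jump t x m \<in> level_event e j} \<in> sets borel"
proof -
  have "jump t x \<in> borel \<rightarrow>\<^sub>M K" using assms by measurable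
  from measurable_sets[OF this sets_level_event] show ?thesis by (simp add: vimage_def)
qed

lemma jump_in_level_event:
  assumes x: "x \<in> space K" and j: "j \<noteq> fst x $ e" and m: "0 \<le> m" "m < real (card moves)"
    and k: "k < card moves" "move k = (e, j)"
  shows "jump t x m \<in> level_event e j \<longleftrightarrow>
    nat \<lfloor>m\<rfloor> = k \<and> (m - of_int \<lfloor>m\<rfloor>) * ceiling_rate < intensity e j t x"
proof -
  obtain e' j' where ej: "move (nat \<lfloor>m\<rfloor>) = (e', j')" by fastforce
  have "nat \<lfloor>m\<rfloor> < card moves" using m by linarith
  then have "e' = e \<and> j' = j \<longleftrightarrow> nat \<lfloor>m\<rfloor> = k"
    using inj_onD[OF bij_betw_imp_inj_on[OF bij_move], of "nat \<lfloor>m\<rfloor>" k] k ej by auto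
  moreover have "jump t x m \<in> level_event e j \<longleftrightarrow> fst (jump t x m) $ e = j"
    using jump_in_space[OF x] by (simp add: level_event_def)
  ultimately show ?thesis
    using j m by (auto simp: jump_def ej)
qed

text \<open>From a level other than j, only the move (e, j) leads to level j at e. The accepted
  marks thus form a single interval that starts at the number of this move and has length intensity
  / \<open>ceiling_rate\<close>.\<close>

lemma measure_jump_other:
  assumes x: "x \<in> space K" and j: "j \<in> {1..C e}" "j \<noteq> fst x $ e"
  shows "measure mark_measure {m. jump t x m \<in> level_event e j} = intensity e j t x / clock_rate"
proof -
  let ?w = "intensity e j t x / ceiling_rate"
  have w: "0 \<le> ?w" "?w < 1" using intensity_bounds[OF x j(1)] ceiling_rate_pos by simp_all
  have "(e, j) \<in> moves" using j by (simp add: moves_def)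
  then obtain k where k: "k < card moves" "move k = (e, j)"
    using bij_betw_imp_surj_on[OF bij_move] by force
  have "{0..<real (card moves)} \<inter> {m. jump t x m \<in> level_event e j} = {real k..<real k + ?w}"
  proof (intro set_eqI iffI)
    fix m assume m: "m \<in> {0..<real (card moves)} \<inter> {m. jump t x m \<in> level_event e j}"
    then have k': "nat \<lfloor>m\<rfloor> = k" and acc: "(m - of_int \<lfloor>m\<rfloor>) * ceiling_rate < intensity e j t x"
      using jump_in_level_event[OF x j(2) _ _ k] by auto
    have fl: "of_int \<lfloor>m\<rfloor> = real k" using m by (simp flip: k')
    have "(m - real k) * ceiling_rate < intensity e j t x" using acc unfolding fl .
    moreover have "real k \<le> m" unfolding fl[symmetric] by (rule of_int_floor_le)
    ultimately show "m \<in> {real k..<real k + ?w}" using ceiling_rate_pos by (simp add: field_simps)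
  next
    fix m assume m: "m \<in> {real k..<real k + ?w}"
    then have fl: "\<lfloor>m\<rfloor> = int k" using w by (intro floor_unique) auto
    have "m < real (card moves)" using m w k(1) by simp
    moreover have "(m - real k) * ceiling_rate < intensity e j t x"
      using m ceiling_rate_pos by (simp add: field_simps)
    ultimately show "m \<in> {0..<real (card moves)} \<inter> {m. jump t x m \<in> level_event e j}"
      using m jump_in_level_event[OF x j(2) _ _ k] fl by auto
  qed
  then have "measure mark_measure {m. jump t x m \<in> level_event e j} = ?w / real (card moves)"
    unfolding mark_measure_def using card_moves_pos w sets_jump_event[OF x]
    by (subst measure_uniform_measure) auto
  then show ?thesis by (simp add: clock_rate_def mult.commute)
qed

lemma intensity_diag:
  assumes "x \<in> space K"
  shows "intensity e (fst x $ e) t x = (\<Sum>j\<in>{1..C e} - {fst x $ e}. intensity e j t x)"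
  using assms unfolding intensity_def
  by (intro rates_diag) (auto simp: space_K levels_def load_space_def)

text \<open>The level at e survives in many ways: by rejection, by a move at another arc, or by an
  accepted proposal of the present level itself, which \<open>moves\<close> includes. Their total is
  found by subtracting the probabilities of the other levels from 1, and
  \<open>intensity_diag\<close> adds those up.\<close>

lemma measure_jump_same:
  assumes x: "x \<in> space K"
  shows "measure mark_measure {m. jump t x m \<in> level_event e (fst x $ e)} =
    1 - intensity e (fst x $ e) t x / clock_rate"
proof -
  let ?A = "\<lambda>j. {m. jump t x m \<in> level_event e j}" and ?i = "fst x $ e"
  have i: "?i \<in> {1..C e}" using x by (auto simp: space_K levels_def)
  have "fst (jump t x m) $ e \<in> {1..C e}" for m
    using jump_in_space[OF x, of t m] by (auto simp: space_K levels_def)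
  then have "(\<Union>j\<in>{1..C e}. ?A j) = UNIV"
    using jump_in_space[OF x, of t] by (auto simp: level_event_def)
  then have "1 = measure mark_measure (\<Union>j\<in>{1..C e}. ?A j)"
    using Q.prob_space by (simp add: space_Q)
  also have "\<dots> = (\<Sum>j\<in>{1..C e}. measure mark_measure (?A j))"
    using sets_jump_event[OF x]
    by (intro Q.finite_measure_finite_Union) (auto simp: disjoint_family_on_def level_event_def sets_Q)
  also have "\<dots> = measure mark_measure (?A ?i) + (\<Sum>j\<in>{1..C e} - {?i}. measure mark_measure (?A j))"
    using i by (intro sum.remove) auto
  also have "(\<Sum>j\<in>{1..C e} - {?i}. measure mark_measure (?A j)) = (\<Sum>j\<in>{1..C e} - {?i}. intensity e j t x / clock_rate)"
    using x by (intro sum.cong measure_jump_other) auto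
  also have "\<dots> = intensity e ?i t x / clock_rate"
    unfolding intensity_diag[OF x] by (simp add: sum_divide_distrib)
  finally show ?thesis by simp
qed

text \<open>Supplies the limit that \<open>kernel_derivative\<close> asks for: at a tick shortly
  after t the rates are evaluated at the drifted load, and continuity of the rates and of the flow
  at its start brings them back to t.\<close>

lemma intensity_flow_tendsto:
  assumes x: "x \<in> space K" and j: "j \<in> {1..C e}"
  shows "((\<lambda>h. intensity e j (t + h) (flow t (t + h) x)) \<longlongrightarrow> intensity e j t x) (at_right 0)"
proof -
  obtain r u where ru: "x = (r, u)" "r \<in> levels" "u \<in> load_space P" using x by (auto simp: space_K)
  note sol = solution_level[OF ru(2)]
  have t: "((\<lambda>h. t + h) \<longlongrightarrow> t) (at_right 0)"
    by (auto intro!: tendsto_eq_intros)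
  have "((\<lambda>h. S (capacity_vector \<mu> r) (clamp_time t) (clamp_time (max t (t + h))) u)
      \<longlongrightarrow> S (capacity_vector \<mu> r) (clamp_time t) (clamp_time t) u) (at_right 0)"
  proof (rule continuous_on_tendsto_compose[OF solution_continuous_time[OF sol]])
    show "((\<lambda>h. clamp_time (max t (t + h))) \<longlongrightarrow> clamp_time t) (at_right 0)"
      using tendsto_max[OF tendsto_const[of t] t] by (intro clamp_time_tendsto) simp
  qed (use ru in \<open>auto intro!: always_eventually clamp_time_mono\<close>)
  then have "((\<lambda>h. load_flow r t (t + h) u) \<longlongrightarrow> u) (at_right 0)"
    using ru by (simp add: load_flow_def solution_refl[OF sol])
  then have "((\<lambda>h. intensity e j (t + h) (r, load_flow r t (t + h) u)) \<longlongrightarrow> intensity e j t (r, u)) (at_right 0)"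
    using ru j t by (intro intensity_tendsto) (auto simp: load_flow_in_load_space)
  then show ?thesis by (simp add: flow_def ru)
qed

lemma flow_level_event: "y \<in> space K \<Longrightarrow> flow s t y \<in> level_event e j \<longleftrightarrow> y \<in> level_event e j"
  using flow_in_space[of y s t] by (simp add: level_event_def) (simp add: flow_def)

section \<open>Rates and paths of the model\<close>

lemma kernel_rates:
  assumes t: "0 < t" "t < T" and x: "(r, q, \<rho>) \<in> space K" and j: "j \<in> {1..C e}"
  shows "(\<lambda>\<Delta>. measure (kernel t (t + \<Delta>) (r, q, \<rho>)) {y \<in> space K. fst y $ e = j} -
      ((1 - \<Delta> * rate e (r $ e) (r $ e) t (q $ e) (\<rho> $ e)) * of_bool (j = r $ e) +
        \<Delta> * rate e (r $ e) j t (q $ e) (\<rho> $ e) * of_bool (j \<noteq> r $ e))) \<in> o[at_right 0](\<lambda>\<Delta>. \<Delta>)"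
proof -
  let ?x = "(r, q, \<rho>)"
  have fst_flow: "fst (flow t (t + h) ?x) = r" for h by (simp add: flow_def)
  have rate: "intensity e i t ?x = rate e (r $ e) i t (q $ e) (\<rho> $ e)" for i
    using t by (simp add: intensity_def)
  have r: "r $ e \<in> {1..C e}" using x by (auto simp: space_K levels_def)
  \<comment> \<open>The probability of level j after a single tick at t. Its difference from the
    indicator of the present level, times \<open>clock_rate\<close>, is the transition rate, or
    minus the total leaving rate if j is the present level.\<close>
  define p where "p = (if j = r $ e then 1 - intensity e j t ?x / clock_rate else intensity e j t ?x / clock_rate)"
  have "measure mark_measure {m. jump (t + h) (flow t (t + h) ?x) m \<in> level_event e j} =
      (if j = r $ e then 1 - intensity e j (t + h) (flow t (t + h) ?x) / clock_rate
       else intensity e j (t + h) (flow t (t + h) ?x) / clock_rate)" for h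
    using measure_jump_same[OF flow_in_space[OF x], of "t + h" t "t + h" e]
      measure_jump_other[OF flow_in_space[OF x] j, of t "t + h" "t + h"]
    by (auto simp: fst_flow)
  moreover have "((\<lambda>h. (if j = r $ e then 1 - intensity e j (t + h) (flow t (t + h) ?x) / clock_rate
       else intensity e j (t + h) (flow t (t + h) ?x) / clock_rate)) \<longlongrightarrow> p) (at_right 0)"
    unfolding p_def using tendsto_divide[OF intensity_flow_tendsto[OF x j] tendsto_const[of clock_rate]] clock_rate_pos
    by (cases "j = r $ e") (simp_all only: if_True if_False, auto intro: tendsto_diff)
  ultimately have lim: "((\<lambda>h. measure mark_measure {m. jump (t + h) (flow t (t + h) ?x) m \<in> level_event e j})
      \<longlongrightarrow> p) (at_right 0)" by simp
  have "indicator (level_event e j) ?x + \<Delta> * clock_rate * (p - indicator (level_event e j) ?x) =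
      (1 - \<Delta> * rate e (r $ e) (r $ e) t (q $ e) (\<rho> $ e)) * of_bool (j = r $ e) +
        \<Delta> * rate e (r $ e) j t (q $ e) (\<rho> $ e) * of_bool (j \<noteq> r $ e)" for \<Delta>
    using clock_rate_pos x by (auto simp: p_def rate level_event_def)
  with kernel_derivative[OF sets_level_event x flow_level_event lim] show ?thesis
    by (simp add: level_event_def)
qed

lemma ex_MLDPNM: "\<exists>(M :: (nat \<Rightarrow> real) measure) X. MLDPNM P S C rate \<mu> x0 M X"
proof -
  obtain M :: "(nat \<Rightarrow> real) measure" and D where
    noise: "prob_space M" "D \<in> M \<rightarrow>\<^sub>M \<Omega>" "distr M \<Omega> D = \<Omega>"
    using ex_noise by blast
  have space_eq: "space K = state_space P C"
    by (simp add: state_measure_def space_restrict_space)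
  interpret driven_jump_flow K mark_measure clock_rate flow jump M D x0
    by (intro driven_jump_flow.intro driven_jump_flow_axioms.intro jump_flow_axioms noise)
      (use initial in \<open>simp add: space_eq\<close>)
  have start: "AE w in M. X 0 w = x0"
    using AE_D[OF AE_process_start[OF x0, of 0]] by (simp add: X_def)
  \<comment> \<open>Both properties concern the whole noise, so one null set serves all times at
    once.\<close>
  have "AE w in M. (\<forall>i. 0 < fst (D w !! i)) \<and> (\<forall>c. \<exists>n. c < jump_time n (D w))"
    using AE_D[OF AE_gaps_pos] AE_D[OF AE_jump_time_unbounded] by eventually_elim simp
  then obtain Z where Z: "{w \<in> space M. \<not> ((\<forall>i. 0 < fst (D w !! i)) \<and> (\<forall>c. \<exists>n. c < jump_time n (D w)))} \<subseteq> Z"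
    "emeasure M Z = 0" "Z \<in> sets M"
    by (rule AE_E)
  have paths: "\<exists>n (\<theta> :: nat \<Rightarrow> real). \<theta> 0 = 0 \<and> \<theta> n = T \<and> (\<forall>k<n. \<theta> k \<le> \<theta> (Suc k)) \<and>
      (\<forall>k<n. (\<lambda>t. capacity_vector \<mu> (fst (X t w))) constant_on {\<theta> k..<\<theta> (Suc k)} \<and>
        (\<forall>t\<in>{\<theta> k..<\<theta> (Suc k)}. snd (X t w) =
          S (capacity_vector \<mu> (fst (X (\<theta> k) w))) (\<theta> k) t (snd (X (\<theta> k) w))))"
    if w: "w \<in> space M - Z" for w
  proof -
    have gaps: "\<forall>i. 0 < fst (D w !! i)" and unbounded: "\<forall>c. \<exists>n. c < jump_time n (D w)"
      using subsetD[OF Z(1), of w] w by blast+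
    obtain n where n: "T < jump_time n (D w)" using unbounded by blast
    \<comment> \<open>Every tick is a partition point, also one whose proposal is rejected; ticks
      after T collapse to T and leave empty intervals.\<close>
    define \<theta> where "\<theta> k = min (jump_time k (D w)) T" for k
    have X_eq: "X t w = flow (\<theta> k) t (X (\<theta> k) w)" and t_bounds: "0 \<le> \<theta> k" "\<theta> k \<le> t" "t \<le> T"
      if "t \<in> {\<theta> k..<\<theta> (Suc k)}" for t k
    proof -
      have "0 \<le> jump_time k (D w)" unfolding jump_time_def using gaps by (intro sum_nonneg) (auto intro: less_imp_le)
      then show "X t w = flow (\<theta> k) t (X (\<theta> k) w)" "0 \<le> \<theta> k" "\<theta> k \<le> t" "t \<le> T"
        unfolding X_def using that horizon_pos
        by (auto simp: \<theta>_def min_def split: if_splits intro!: process_between_jumps[OF x0 gaps, of _ _ k])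
    qed
    have snd_X: "snd (X t w) = S (capacity_vector \<mu> (fst (X (\<theta> k) w))) (\<theta> k) t (snd (X (\<theta> k) w))"
      and fst_X: "fst (X t w) = fst (X (\<theta> k) w)" if "t \<in> {\<theta> k..<\<theta> (Suc k)}" for t k
      using X_eq[OF that] t_bounds[OF that] by (simp_all add: flow_def load_flow_def max_absorb2)
    have capacity: "\<exists>m. \<forall>t\<in>{\<theta> k..<\<theta> (Suc k)}. capacity_vector \<mu> (fst (X t w)) = m" for k
      by (intro exI[of _ "capacity_vector \<mu> (fst (X (\<theta> k) w))"] ballI arg_cong[where f="capacity_vector \<mu>"] fst_X)
    have mono: "\<theta> k \<le> \<theta> (Suc k)" for k
      using less_imp_le[OF gaps[rule_format, of k]] by (simp add: \<theta>_def jump_time_def min_le_iff_disj)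
    have ends: "\<theta> 0 = 0" "\<theta> n = T" using horizon_pos n by (simp_all add: \<theta>_def)
    show ?thesis
      unfolding constant_on_def
      by (intro exI[of _ n] exI[of _ \<theta>] conjI allI impI ballI ends mono capacity snd_X)
  qed
  have "MLDPNM P S C rate \<mu> x0 M X"
    unfolding MLDPNM_def Let_def
  proof (intro conjI exI[of _ kernel] bexI[of _ Z])
    show "prob_space M" by (rule noise)
    show "\<forall>t\<in>{0..T}. X t \<in> M \<rightarrow>\<^sub>M K" by simp
    show "AE w in M. X 0 w = x0" by (rule start)
    show "markov_process M K T X" by (rule X_markov_process)
    show "transition_function M K T X kernel" by (rule X_transition_function)
    show "\<forall>w\<in>space M - Z. \<exists>n (\<theta> :: nat \<Rightarrow> real). \<theta> 0 = 0 \<and> \<theta> n = T \<and> (\<forall>k<n. \<theta> k \<le> \<theta> (Suc k)) \<and>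
      (\<forall>k<n. (\<lambda>t. capacity_vector \<mu> (fst (X t w))) constant_on {\<theta> k..<\<theta> (Suc k)} \<and>
        (\<forall>t\<in>{\<theta> k..<\<theta> (Suc k)}. snd (X t w) =
          S (capacity_vector \<mu> (fst (X (\<theta> k) w))) (\<theta> k) t (snd (X (\<theta> k) w))))"
      using paths by blast
    show "Z \<in> null_sets M" using Z by auto
    show "\<forall>t\<in>{0<..<T}. \<forall>(r, q, \<rho>)\<in>state_space P C. \<forall>e. \<forall>j\<in>{1..C e}.
          (\<lambda>\<Delta>. measure (kernel t (t + \<Delta>) (r, q, \<rho>)) {y \<in> space K. fst y $ e = j} -
                ((1 - \<Delta> * rate e (r $ e) (r $ e) t (q $ e) (\<rho> $ e)) * of_bool (j = r $ e) +
                 \<Delta> * rate e (r $ e) j t (q $ e) (\<rho> $ e) * of_bool (j \<noteq> r $ e)))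
          \<in> o[at_right 0](\<lambda>\<Delta>. \<Delta>)"
    proof (intro ballI)
      fix t x assume t: "t \<in> {0<..<T}" and "x \<in> state_space P C"
      moreover obtain r q \<rho> where "x = (r, q, \<rho>)" by (metis surj_pair)
      ultimately show "case x of (r, q, \<rho>) \<Rightarrow> \<forall>e. \<forall>j\<in>{1..C e}.
          (\<lambda>\<Delta>. measure (kernel t (t + \<Delta>) (r, q, \<rho>)) {y \<in> space K. fst y $ e = j} -
                ((1 - \<Delta> * rate e (r $ e) (r $ e) t (q $ e) (\<rho> $ e)) * of_bool (j = r $ e) +
                 \<Delta> * rate e (r $ e) j t (q $ e) (\<rho> $ e) * of_bool (j \<noteq> r $ e)))
          \<in> o[at_right 0](\<lambda>\<Delta>. \<Delta>)"
        by (simp only: prod.case, intro allI ballI kernel_rates) (simp_all add: space_eq)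
    qed
  qed
  then show ?thesis by blast
qed

end

theorem theorem2p10:
  fixes P :: "('v, 'e::finite) production_network"
    and S :: "real ^ 'e \<Rightarrow> real \<Rightarrow> real \<Rightarrow> 'e load \<Rightarrow> 'e load"
    and C :: "'e \<Rightarrow> nat"
    and \<mu> :: "'e \<Rightarrow> nat \<Rightarrow> real"
    and rate :: "'e \<Rightarrow> nat \<Rightarrow> nat \<Rightarrow> real \<Rightarrow> real \<Rightarrow> l1 \<Rightarrow> real"
    and rate_bound :: "'e \<Rightarrow> real"
    and x0 :: "'e state"
  assumes network: "is_production_network P"
    and inflow_BV: "\<And>v. v \<in> V_in P \<Longrightarrow> TV 0 (horizon P) (inflow P v) < \<infinity>"
    and solution: "\<And>m. (\<And>e. 0 \<le> m $ e) \<Longrightarrow> solution_operator P m (S m)"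
    and capacity_nonneg: "\<And>e i. i \<in> {1..C e} \<Longrightarrow> 0 \<le> \<mu> e i"
    and rates_continuous: "\<And>e i j. i \<in> {1..C e} \<Longrightarrow> j \<in> {1..C e} \<Longrightarrow>
      continuous_on ({0..horizon P} \<times> {0..} \<times> L1_interval (lo P e) (hi P e))
        (\<lambda>(t, q, \<rho>). rate e i j t q \<rho>)"
    and rates_nonneg: "\<And>e i j t q \<rho>. i \<in> {1..C e} \<Longrightarrow> j \<in> {1..C e} \<Longrightarrow>
      t \<in> {0..horizon P} \<Longrightarrow> 0 \<le> q \<Longrightarrow> \<rho> \<in> L1_interval (lo P e) (hi P e) \<Longrightarrow>
      0 \<le> rate e i j t q \<rho>"
    and rates_diag: "\<And>e i t q \<rho>. i \<in> {1..C e} \<Longrightarrow>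
      t \<in> {0..horizon P} \<Longrightarrow> 0 \<le> q \<Longrightarrow> \<rho> \<in> L1_interval (lo P e) (hi P e) \<Longrightarrow>
      rate e i i t q \<rho> = (\<Sum>j\<in>{1..C e} - {i}. rate e i j t q \<rho>)"
    and rates_bounded: "\<And>e i j t q \<rho>. i \<in> {1..C e} \<Longrightarrow> j \<in> {1..C e} \<Longrightarrow>
      t \<in> {0..horizon P} \<Longrightarrow> 0 \<le> q \<Longrightarrow> \<rho> \<in> L1_interval (lo P e) (hi P e) \<Longrightarrow>
      rate e i j t q \<rho> \<le> rate_bound e"
    and initial: "x0 \<in> state_space P C"
  shows "\<exists>(M :: (nat \<Rightarrow> real) measure) X. MLDPNM P S C rate \<mu> x0 M X"
proof -
  have "production_model P S C \<mu> rate rate_bound x0"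
    using network solution capacity_nonneg rates_continuous rates_nonneg rates_diag rates_bounded initial
    by (rule production_model.intro)
  then show ?thesis by (rule production_model.ex_MLDPNM)
qed

end
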